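(* Let $D\ge 1$, let $\mathcal{X}=[\underline{x}_1,\overline{x}_1]\times\cdots\times[\underline{x}_D,\overline{x}_D]\subset\mathbb{R}^D$ be a hyperrectangle (with $\underline{x}_i<\overline{x}_i$), and let $\overline{N}=(N_1,\dots,N_D)$ with integers $N_i\ge 1$. Let $f:\mathcal{X}\to\mathbb{R}$ have an analytic extension (also denoted $f$) to the generalized Bernstein ellipse $B(\mathcal{X},\varrho)$ for some parameter vector $\varrho=(\varrho_1,\dots,\varrho_D)\in(1,\infty)^D$, with $|f(x)|\le V<\infty$ for all $x\in B(\mathcal{X},\varrho)$. Let $I_{\overline{N}}(f)$ be the tensorized Chebyshev interpolation of $f$ on $\mathcal{X}$. Then $$\max_{x\in\mathcal{X}}\big|f(x)-I_{\overline{N}}(f)(x)\big|\le\min_{\sigma\in S_D}\left(\sum_{i=1}^D 4V\frac{\varrho_{\sigma(i)}^{-N_{\sigma(i)}}}{\varrho_{\sigma(i)}-1}+\sum_{k=2}^D 4V\frac{\varrho_{\sigma(k)}^{-N_{\sigma(k)}}}{\varrho_{\sigma(k)}-1}\cdot 2^{k-1}\,\frac{(k-1)+2^{k-1}-1}{\prod_{j=1}^{k-1}\big(1-\frac{1}{\varrho_{\sigma(j)}}\big)}\right),$$ where $S_D$ denotes the symmetric group on $D$ elements.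
   Context: Tensorized Chebyshev interpolation on $[-1,1]^D$: $T_n$ is the $n$-th Chebyshev polynomial of the first kind, $T_n(\cos\theta)=\cos(n\theta)$. Let $J=\{(j_1,\dots,j_D)\in\mathbb{N}_0^D: j_i\le N_i \text{ for all } i\}$. For $f$ on $[-1,1]^D$, $$I_{\overline N}(f)(x)=\sum_{j\in J}c_jT_j(x),\qquad T_j(x_1,\dots,x_D)=\prod_{i=1}^DT_{j_i}(x_i),$$ $$c_j=\Big(\prod_{i=1}^D\frac{2^{\mathbf 1_{\{0<j_i<N_i\}}}}{N_i}\Big)\sum_{k_1=0}^{N_1}{}^{''}\cdots\sum_{k_D=0}^{N_D}{}^{''}f(x^{(k_1,\dots,k_D)})\prod_{i=1}^D\cos\Big(j_i\pi\frac{k_i}{N_i}\Big),$$ where $\sum''$ means that the first and last summands are halved, and the nodes are $x^{(k_1,\dots,k_D)}=(x_{k_1},\dots,x_{k_D})$ with $x_{k_i}=\cos(\pi k_i/N_i)$, $k_i=0,\dots,N_i$. For a general hyperrectangle $\mathcal{X}$, $I_{\overline N}(f)$ is obtained by transporting to $[-1,1]^D$ with the componentwise affine maps $\tau_{[\underline{x}_i,\overline{x}_i]}$: with $\tau=(\tau_{[\underline{x}_1,\overline{x}_1]},\dots,\tau_{[\underline{x}_D,\overline{x}_D]})$, $I_{\overline N}(f)=I_{\overline N}(f\circ\tau)\circ\tau^{-1}$, where $\tau_{[\underline{x},\overline{x}]}(z)=\overline{x}+\frac{\underline{x}-\overline{x}}{2}(1-z)$, i.e. real parts are sent to $\overline{x}+\frac{\underline{x}-\overline{x}}{2}(1-\Re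 z)$ and imaginary parts to $\frac{\overline{x}-\underline{x}}{2}\Im z$. Bernstein ellipses: for $r>1$, $B([-1,1],r)\subset\mathbb{C}$ is the open region bounded by the ellipse with foci $\pm1$ whose semi-axis lengths sum to $r$ (the image of $|z|=r$ under $z\mapsto(z+z^{-1})/2$). $B([\underline{x},\overline{x}],r)=\tau_{[\underline{x},\overline{x}]}(B([-1,1],r))$. The generalized Bernstein ellipse is $B(\mathcal{X},\varrho)=B([\underline{x}_1,\overline{x}_1],\varrho_1)\times\cdots\times B([\underline{x}_D,\overline{x}_D],\varrho_D)\subset\mathbb{C}^D$. *)

theory Defs
  imports
    "HOL-Analysis.Analysis"
    "HOL-Computational_Algebra.Polynomial"
    "HOL-Combinatorics.Permutations"
begin

section \<open>Tensorized Chebyshev interpolation\<close>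

fun chebyshev_T :: "nat \<Rightarrow> real poly" where
  "chebyshev_T 0 = 1"
| "chebyshev_T (Suc 0) = [:0, 1:]"
| "chebyshev_T (Suc (Suc n)) = [:0, 2:] * chebyshev_T (Suc n) - chebyshev_T n"

lemma poly_chebyshev_T_cos: "poly (chebyshev_T n) (cos t) = cos (real n * t)"
proof (induction n rule: chebyshev_T.induct)
  case (3 n)
  have "cos (real (Suc (Suc n)) * t) + cos (real n * t) = 2 * cos t * cos (real (Suc n) * t)"
  proof -
    have "real (Suc (Suc n)) * t = real (Suc n) * t + t" "real n * t = real (Suc n) * t - t"
      by (simp_all add: algebra_simps)
    then show ?thesis by (simp only: cos_add cos_diff mult_2 distrib_right) (simp add: mult.commute)
  qed
  then show ?case using 3 by simp
qed auto

definition cheb_node :: "nat \<Rightarrow> nat \<Rightarrow> real" where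
  "cheb_node n k = cos (pi * real k / real n)"

text \<open>The iterated sums with first and last summands halved are written as one sum over all
  multi-indices \<open>k\<close> carrying the product of the one-dimensional weights.\<close>

definition endpoint_weight :: "nat \<Rightarrow> nat \<Rightarrow> real" where
  "endpoint_weight n k = (if k = 0 \<or> k = n then 1 / 2 else 1)"

definition cheb_coeff :: "('n::finite \<Rightarrow> nat) \<Rightarrow> (real ^ 'n \<Rightarrow> real) \<Rightarrow> ('n \<Rightarrow> nat) \<Rightarrow> real" where
  "cheb_coeff N f j =
     (\<Prod>i\<in>UNIV. (if 0 < j i \<and> j i < N i then 2 else 1) / real (N i)) *
     (\<Sum>k\<in>{k. \<forall>i. k i \<le> N i}.
        (\<Prod>i\<in>UNIV. endpoint_weight (N i) (k i)) *
        f (\<chi> i. cheb_node (N i) (k i)) *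
        (\<Prod>i\<in>UNIV. cos (real (j i) * pi * (real (k i) / real (N i)))))"

definition cheb_interp_unit :: "('n::finite \<Rightarrow> nat) \<Rightarrow> (real ^ 'n \<Rightarrow> real) \<Rightarrow> real ^ 'n \<Rightarrow> real" where
  "cheb_interp_unit N f x =
     (\<Sum>j\<in>{j. \<forall>i. j i \<le> N i}. cheb_coeff N f j * (\<Prod>i\<in>UNIV. poly (chebyshev_T (j i)) (x $ i)))"

definition tau :: "real \<Rightarrow> real \<Rightarrow> 'a::real_normed_field \<Rightarrow> 'a" where
  "tau l u z = of_real u + of_real ((l - u) / 2) * (1 - z)"

lemma Re_tau: "Re (tau l u z) = u + (l - u) / 2 * (1 - Re z)"
  and Im_tau: "Im (tau l u z) = (u - l) / 2 * Im z"
  by (simp_all add: tau_def field_simps)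

definition tau_vec :: "real ^ 'n \<Rightarrow> real ^ 'n \<Rightarrow> real ^ 'n::finite \<Rightarrow> real ^ 'n" where
  "tau_vec l u x = (\<chi> i. tau (l $ i) (u $ i) (x $ i))"

definition cheb_interp ::
  "real ^ 'n \<Rightarrow> real ^ 'n \<Rightarrow> ('n::finite \<Rightarrow> nat) \<Rightarrow> (real ^ 'n \<Rightarrow> real) \<Rightarrow> real ^ 'n \<Rightarrow> real" where
  "cheb_interp l u N f = cheb_interp_unit N (f \<circ> tau_vec l u) \<circ> inv (tau_vec l u)"


section \<open>Bernstein ellipses\<close>

text \<open>An ellipse with foci \<open>1\<close> and \<open>-1\<close> and semi-axes \<open>a > b\<close> has \<open>a\<^sup>2 - b\<^sup>2 = 1\<close>, so
  \<open>a + b = r\<close> forces \<open>a - b = 1 / r\<close>, and the sum of the distances to the foci is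
  \<open>2 * a = r + 1 / r\<close> on the ellipse and smaller than that in the region it bounds.\<close>

definition bernstein :: "real \<Rightarrow> complex set" where
  "bernstein r = {z. dist z 1 + dist z (-1) < r + 1 / r}"

lemma joukowski_dist_foci:
  fixes w :: complex
  assumes "w \<noteq> 0"
  shows "dist ((w + inverse w) / 2) 1 + dist ((w + inverse w) / 2) (-1) = cmod w + 1 / cmod w"
proof -
  have 1: "(w + inverse w) / 2 - 1 = (w - 1)\<^sup>2 / (2 * w)"
    using assms by (simp add: field_simps power2_eq_square)
  have 2: "(w + inverse w) / 2 - (-1) = (w + 1)\<^sup>2 / (2 * w)"
    using assms by (simp add: field_simps power2_eq_square)
  have 3: "(cmod (w - 1))\<^sup>2 + (cmod (w + 1))\<^sup>2 = 2 * (cmod w)\<^sup>2 + 2"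
    unfolding cmod_power2 by (simp add: power2_eq_square algebra_simps)
  have "dist ((w + inverse w) / 2) 1 + dist ((w + inverse w) / 2) (-1)
      = ((cmod (w - 1))\<^sup>2 + (cmod (w + 1))\<^sup>2) / (2 * cmod w)"
    unfolding dist_norm 1 2 by (simp add: norm_divide norm_power norm_mult add_divide_distrib)
  also have "\<dots> = cmod w + 1 / cmod w"
    unfolding 3 using assms by (simp add: field_simps power2_eq_square)
  finally show ?thesis .
qed

lemma joukowski_image_circle:
  assumes "r > 1"
  shows "(\<lambda>w::complex. (w + inverse w) / 2) ` sphere 0 r =
         {z. dist z 1 + dist z (-1) = r + 1 / r}" (is "?L = ?R")
proof
  show "?L \<subseteq> ?R"
  proof clarify
    fix w :: complex assume "w \<in> sphere 0 r"
    then have "cmod w = r" "w \<noteq> 0" using assms by auto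
    then show "dist ((w + inverse w) / 2) 1 + dist ((w + inverse w) / 2) (-1) = r + 1 / r"
      using joukowski_dist_foci[of w] by metis
  qed
  show "?R \<subseteq> ?L"
  proof clarify
    fix z :: complex
    assume z: "dist z 1 + dist z (-1) = r + 1 / r"
    define w where "w = z + csqrt (z\<^sup>2 - 1)"
    define w' where "w' = z - csqrt (z\<^sup>2 - 1)"
    have ww': "w * w' = 1"
      unfolding w_def w'_def
      by (metis (no_types, lifting) diff_diff_eq2 diff_self add.left_neutral add_diff_cancel_left'
          power2_csqrt power2_eq_square square_diff_square_factored)
    then have nz: "w \<noteq> 0" "w' \<noteq> 0" by auto
    have inv: "inverse w = w'" "inverse w' = w" using ww' nz
      by (auto simp: field_simps)
    have zw: "z = (w + inverse w) / 2" "z = (w' + inverse w') / 2"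
      unfolding inv by (simp_all add: w_def w'_def)
    have "cmod w + 1 / cmod w = r + 1 / r"
      using joukowski_dist_foci[OF nz(1)] z zw(1) by simp
    then have "(cmod w - r) * (cmod w * r - 1) = 0"
      using nz assms by (simp add: field_simps)
    then have "cmod w - r = 0 \<or> cmod w * r - 1 = 0" by (simp only: mult_eq_0_iff)
    then have "cmod w = r \<or> cmod w = 1 / r" using assms by (auto simp: eq_divide_eq)
    then consider "cmod w = r" | "cmod w' = r"
      using inv(1) assms by (metis norm_inverse inverse_eq_divide inverse_inverse_eq)
    then show "z \<in> ?L"
    proof cases
      case 1 then show ?thesis using zw(1) by (intro image_eqI[of _ _ w]) auto
    next
      case 2 then show ?thesis using zw(2) by (intro image_eqI[of _ _ w']) auto
    qed
  qed
qed

definition bernstein_interval :: "real \<Rightarrow> real \<Rightarrow> real \<Rightarrow> complex set" where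
  "bernstein_interval l u r = tau l u ` bernstein r"

definition gen_bernstein :: "real ^ 'n \<Rightarrow> real ^ 'n \<Rightarrow> real ^ 'n \<Rightarrow> (complex ^ 'n::finite) set" where
  "gen_bernstein l u \<rho> = {z. \<forall>i. z $ i \<in> bernstein_interval (l $ i) (u $ i) (\<rho> $ i)}"


section \<open>Analytic functions of several complex variables\<close>

text \<open>As with \<^const>\<open>analytic_on\<close> in one variable, the expansion is required on a full
  neighbourhood of every point of \<open>S\<close>. Multi-indices are functions \<open>\<alpha> :: 'n \<Rightarrow> nat\<close>; the sum over
  all of them is unordered, i.e. absolutely convergent.\<close>

definition mv_analytic_on :: "(complex ^ 'n::finite \<Rightarrow> complex) \<Rightarrow> (complex ^ 'n) set \<Rightarrow> bool" where
  "mv_analytic_on F S \<longleftrightarrow>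
     (\<forall>a\<in>S. \<exists>(c :: ('n \<Rightarrow> nat) \<Rightarrow> complex) \<epsilon>. \<epsilon> > 0 \<and>
        (\<forall>z. (\<forall>i. cmod (z $ i - a $ i) < \<epsilon>) \<longrightarrow>
           ((\<lambda>\<alpha>. c \<alpha> * (\<Prod>i\<in>UNIV. (z $ i - a $ i) ^ \<alpha> i)) has_sum F z) UNIV))"

definition complex_vec :: "real ^ 'n \<Rightarrow> complex ^ 'n::finite" where
  "complex_vec x = (\<chi> i. complex_of_real (x $ i))"

end

theory Submission
  imports Defs "HOL-Complex_Analysis.Cauchy_Integral_Formula"
begin

text \<open>In one variable, a function \<open>h\<close> bounded by \<open>M\<close> on the Bernstein ellipse of parameter \<open>r\<close> pulls
  back under \<open>w \<mapsto> (w + 1 / w) / 2\<close> to an annulus, where its Laurent series yields a Chebyshev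
  series with coefficients at most \<open>2 * M / s ^ n\<close> for every \<open>s < r\<close>. At the nodes each \<open>T\<^sub>n\<close> coincides
  with some \<open>T\<^sub>m\<close>, \<open>m \<le> N\<close>, so its interpolant is bounded by \<open>1\<close> on the interval. Hence the
  interpolation error is at most \<open>4 * M / (r ^ N * (r - 1))\<close> and the interpolant itself at most
  \<open>2 * M / (1 - 1 / r)\<close>, independently of \<open>N\<close>. In several variables one telescopes the error over the
  coordinates in the order given by \<open>\<sigma>\<close>: the \<open>k\<close>-th term interpolates, in the first \<open>k - 1\<close>
  coordinates, the one-dimensional error in coordinate \<open>k\<close>. That gives the factor
  \<open>2 ^ (k - 1) / (\<Prod>j<k. 1 - 1 / \<rho>\<^sub>j)\<close>, and the claimed factor
  carries in addition \<open>(k - 1) + 2 ^ (k - 1) - 1 \<ge> 1\<close> for \<open>k \<ge> 2\<close>.\<close>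

section \<open>Aliasing of Chebyshev polynomials\<close>

text \<open>This is the composite trapezoidal rule: an interior value is shared by two neighbouring
  intervals, an end value belongs to only one.\<close>

lemma sum_endpoint_weight:
  fixes \<phi> :: "nat \<Rightarrow> real"
  assumes "N \<ge> 1"
  shows "(\<Sum>k\<le>N. endpoint_weight N k * \<phi> k) = (\<Sum>k<N. (\<phi> k + \<phi> (Suc k)) / 2)"
proof -
  have "(\<Sum>k<N. (\<phi> k + \<phi> (Suc k)) / 2) = (\<Sum>k<N. \<phi> k) / 2 + (\<Sum>k<N. \<phi> (Suc k)) / 2"
    by (simp add: sum.distrib add_divide_distrib sum_divide_distrib)
  also have "(\<Sum>k<N. \<phi> k) = \<phi> 0 + (\<Sum>k=1..<N. \<phi> k)"
    using assms by (metis One_nat_def Suc_le_lessD lessThan_atLeast0 sum.atLeast_Suc_lessThan)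
  also have "(\<Sum>k<N. \<phi> (Suc k)) = (\<Sum>k=1..<N. \<phi> k) + \<phi> N"
  proof -
    have "(\<Sum>k<N. \<phi> (Suc k)) = (\<Sum>k=1..<Suc N. \<phi> k)"
      by (simp only: lessThan_atLeast0 One_nat_def sum.shift_bounds_Suc_ivl)
    then show ?thesis using assms by simp
  qed
  finally have 1: "(\<Sum>k<N. (\<phi> k + \<phi> (Suc k)) / 2) = \<phi> 0 / 2 + (\<Sum>k=1..<N. \<phi> k) + \<phi> N / 2"
    by (simp add: field_simps)
  have "{..N} = insert 0 (insert N {1..<N})" using assms by auto
  then have "(\<Sum>k\<le>N. endpoint_weight N k * \<phi> k) =
      \<phi> 0 / 2 + \<phi> N / 2 + (\<Sum>k=1..<N. endpoint_weight N k * \<phi> k)"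
    using assms by (simp add: endpoint_weight_def)
  also have "(\<Sum>k=1..<N. endpoint_weight N k * \<phi> k) = (\<Sum>k=1..<N. \<phi> k)"
    by (intro sum.cong) (auto simp: endpoint_weight_def)
  finally show ?thesis using 1 by simp
qed

text \<open>With \<open>\<theta> = p * pi / N\<close>, multiplying the trapezoidal sum by
  \<open>sin (\<theta> / 2)\<close> makes it telescope to a multiple of
  \<open>sin (N * \<theta>) = 0\<close>. The factor \<open>sin (\<theta> / 2)\<close> vanishes only
  if \<open>2 * N\<close> divides \<open>p\<close>, and then every cosine equals 1.\<close>

lemma endpoint_sum_cos:
  assumes N: "N \<ge> 1"
  shows "(\<Sum>k\<le>N. endpoint_weight N k * cos (real_of_int p * pi * (real k / real N))) =
    (if 2 * int N dvd p then real N else 0)"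
proof -
  define \<theta> where "\<theta> = real_of_int p * pi / real N"
  have arg: "real_of_int p * pi * (real k / real N) = real k * \<theta>" for k
    by (simp add: \<theta>_def)
  have T: "sin (\<theta> / 2) * (\<Sum>k<N. (cos (real k * \<theta>) + cos (real (Suc k) * \<theta>)) / 2) =
      cos (\<theta> / 2) * sin (real N * \<theta>) / 2"
  proof -
    have "sin (\<theta> / 2) * ((cos (real k * \<theta>) + cos (real (Suc k) * \<theta>)) / 2) =
      cos (\<theta> / 2) / 2 * (sin (real (Suc k) * \<theta>) - sin (real k * \<theta>))" for k
    proof -
      \<comment> \<open>Around the midpoint \<open>c\<close> of the two angles both sides become
        \<open>sin (\<theta> / 2) * cos (\<theta> / 2) * cos c\<close>.\<close>
      define c where "c = real k * \<theta> + \<theta> / 2"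
      have a: "real k * \<theta> = c - \<theta> / 2" "real (Suc k) * \<theta> = c + \<theta> / 2"
        by (simp_all add: c_def field_simps)
      show ?thesis unfolding a by (simp add: cos_add cos_diff sin_add sin_diff)
    qed
    then have "sin (\<theta> / 2) * (\<Sum>k<N. (cos (real k * \<theta>) + cos (real (Suc k) * \<theta>)) / 2) =
      cos (\<theta> / 2) / 2 * (\<Sum>k<N. sin (real (Suc k) * \<theta>) - sin (real k * \<theta>))"
      by (simp only: sum_distrib_left)
    then show ?thesis
      using sum_lessThan_telescope[of "\<lambda>k. sin (real k * \<theta>)" N] by simp
  qed
  have "real N * \<theta> = real_of_int p * pi" using N by (simp add: \<theta>_def)
  then have sN: "sin (real N * \<theta>) = 0" by (simp add: sin_zero_iff_int2 exI[of _ p])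
  show ?thesis
  proof (cases "2 * int N dvd p")
    case True
    then obtain q where q: "p = 2 * int N * q" by (auto simp: dvd_def)
    have "cos (real_of_int p * pi * (real k / real N)) = 1" for k
    proof -
      have "real_of_int p * pi * (real k / real N) = 2 * pi * real_of_int (q * int k)"
        using N by (simp add: q)
      then show ?thesis by (simp only: cos_int_2pin)
    qed
    then show ?thesis using True sum_endpoint_weight[OF N, of "\<lambda>_. 1"] by simp
  next
    case False
    have "sin (\<theta> / 2) \<noteq> 0"
    proof
      assume "sin (\<theta> / 2) = 0"
      then obtain q where "\<theta> / 2 = real_of_int q * pi" by (auto simp: sin_zero_iff_int2)
      then have "real_of_int p = real_of_int (2 * int N * q)"
        using N by (simp add: \<theta>_def field_simps)
      then have "p = 2 * int N * q" by (simp only: of_int_eq_iff)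
      then show False using False by simp
    qed
    then have "(\<Sum>k<N. (cos (real k * \<theta>) + cos (real (Suc k) * \<theta>)) / 2) = 0"
      using T sN by simp
    then show ?thesis using False
      unfolding arg sum_endpoint_weight[OF N] by simp
  qed
qed

text \<open>For \<open>N \<ge> 1\<close> this is the Lagrange basis polynomial of the node
  \<open>k\<close>, expanded in Chebyshev polynomials: the interpolation formula regrouped by nodes
  instead of degrees.\<close>

definition cheb_lagrange :: "nat \<Rightarrow> nat \<Rightarrow> real \<Rightarrow> real" where
  "cheb_lagrange N k x = (\<Sum>j\<le>N. (if 0 < j \<and> j < N then 2 else 1) / real N * endpoint_weight N k *
     cos (real j * pi * (real k / real N)) * poly (chebyshev_T j) x)"

text \<open>The product formula for cosines leaves the frequencies \<open>j + m\<close> and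
  \<open>j - m\<close>. For degrees up to \<open>N\<close>, the first is a multiple of
  \<open>2 * N\<close> only if \<open>j = m\<close> is 0 or \<open>N\<close>, the second only if
  \<open>j = m\<close>. The double contribution at the two extreme degrees replaces the factor 2
  that they lack.\<close>

lemma cheb_discrete_orthogonality:
  assumes N: "N \<ge> 1" and "j \<le> N" "m \<le> N"
  shows "(if 0 < j \<and> j < N then 2 else 1) / real N *
    (\<Sum>k\<le>N. endpoint_weight N k * (cos (real j * pi * (real k / real N)) *
       cos (real m * pi * (real k / real N)))) = (if j = m then 1 else 0)"
proof -
  define S where "S p = (\<Sum>k\<le>N. endpoint_weight N k * cos (real_of_int p * pi * (real k / real N)))" for p
  have "(\<Sum>k\<le>N. endpoint_weight N k * (cos (real j * pi * (real k / real N)) *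
       cos (real m * pi * (real k / real N)))) = (S (int j + int m) + S (int j - int m)) / 2"
    unfolding S_def sum.distrib[symmetric] sum_divide_distrib
    by (intro sum.cong refl) (simp add: cos_times_cos algebra_simps)
  moreover have "2 * int N dvd int j + int m \<longleftrightarrow> j = m \<and> (j = 0 \<or> j = N)"
  proof
    assume d: "2 * int N dvd int j + int m"
    then obtain q where q: "int j + int m = 2 * int N * q" by (auto simp: dvd_def)
    have "int j + int m = 0 \<or> 2 * int N \<le> int j + int m"
      using zdvd_imp_le[OF d] by linarith
    then show "j = m \<and> (j = 0 \<or> j = N)" using assms by auto
  qed auto
  moreover have "2 * int N dvd int j - int m \<longleftrightarrow> j = m"
  proof
    assume d: "2 * int N dvd int j - int m"
    show "j = m"
    proof (rule ccontr)
      assume "j \<noteq> m"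
      then have "2 * int N \<le> \<bar>int j - int m\<bar>" using d by (intro zdvd_imp_le) auto
      then show False using assms by auto
    qed
  qed auto
  ultimately show ?thesis
    using N assms unfolding S_def endpoint_sum_cos[OF N] by auto
qed

text \<open>On the nodes the cosine is periodic in \<open>n\<close> with period
  \<open>2 * N\<close>, and the reflection of \<open>p\<close> to \<open>2 * N - p\<close> folds the
  remaining degrees above \<open>N\<close> back.\<close>

lemma cheb_alias:
  assumes N: "N \<ge> 1"
  obtains m where "m \<le> N"
    "\<And>k. cos (real n * pi * (real k / real N)) = cos (real m * pi * (real k / real N))"
proof -
  define p where "p = n mod (2 * N)"
  define q where "q = n div (2 * N)"
  have n: "n = 2 * N * q + p" by (simp add: p_def q_def)
  have p: "p < 2 * N" using N by (simp add: p_def)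
  have c: "cos (real n * pi * (real k / real N)) = cos (real p * pi * (real k / real N))" for k
  proof -
    have "real n * pi * (real k / real N) = real p * pi * (real k / real N) + 2 * real (q * k) * pi"
      using N by (simp add: n field_simps)
    then show ?thesis by (simp add: cos_add del: of_nat_mult)
  qed
  show thesis
  proof (cases "p \<le> N")
    case True
    show thesis by (rule that[OF True c])
  next
    case False
    have c': "cos (real p * pi * (real k / real N)) = cos (real (2 * N - p) * pi * (real k / real N))" for k
    proof -
      have "real (2 * N - p) * pi * (real k / real N) = 2 * real k * pi - real p * pi * (real k / real N)"
        using N p by (simp add: of_nat_diff field_simps)
      then show ?thesis by (simp only: cos_diff cos_2npi sin_2npi)
    qed
    show thesis
    proof (rule that)
      show "2 * N - p \<le> N" using False by simp
      show "cos (real n * pi * (real k / real N)) = cos (real (2 * N - p) * pi * (real k / real N))" for k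
        unfolding c by (rule c')
    qed
  qed
qed

lemma cheb_interp_chebyshev:
  assumes N: "N \<ge> 1" and m: "m \<le> N"
  shows "(\<Sum>k\<le>N. cheb_lagrange N k x * cos (real m * pi * (real k / real N))) = poly (chebyshev_T m) x"
proof -
  have "(\<Sum>k\<le>N. cheb_lagrange N k x * cos (real m * pi * (real k / real N))) =
    (\<Sum>k\<le>N. \<Sum>j\<le>N. ((if 0 < j \<and> j < N then 2 else 1) / real N * (endpoint_weight N k * (cos (real j * pi * (real k / real N)) *
       cos (real m * pi * (real k / real N))))) * poly (chebyshev_T j) x)"
    unfolding cheb_lagrange_def sum_distrib_right by (intro sum.cong refl) (simp add: mult_ac)
  also have "\<dots> = (\<Sum>j\<le>N. ((if 0 < j \<and> j < N then 2 else 1) / real N * (\<Sum>k\<le>N. endpoint_weight N k * (cos (real j * pi * (real k / real N)) *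
       cos (real m * pi * (real k / real N))))) * poly (chebyshev_T j) x)"
    by (subst sum.swap) (simp add: sum_distrib_left sum_distrib_right)
  also have "\<dots> = (\<Sum>j\<le>N. (if j = m then 1 else 0) * poly (chebyshev_T j) x)"
    by (intro sum.cong refl, subst cheb_discrete_orthogonality) (use N m in auto)
  also have "\<dots> = poly (chebyshev_T m) x" using m by (simp add: if_distrib if_distribR cong: if_cong)
  finally show ?thesis .
qed

lemma abs_poly_chebyshev_T_le_1:
  assumes "x \<in> {-1..1}"
  shows "\<bar>poly (chebyshev_T n) x\<bar> \<le> 1"
proof -
  have "poly (chebyshev_T n) x = cos (real n * arccos x)"
    using assms poly_chebyshev_T_cos[of n "arccos x"] by (simp add: cos_arccos)
  then show ?thesis by simp
qed

definition cheb_interp_chebyshev_T :: "nat \<Rightarrow> nat \<Rightarrow> real \<Rightarrow> real" where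
  "cheb_interp_chebyshev_T N n x = (\<Sum>k\<le>N. cheb_lagrange N k x * poly (chebyshev_T n) (cheb_node N k))"

lemma poly_chebyshev_T_node:
  "poly (chebyshev_T n) (cheb_node N k) = cos (real n * pi * (real k / real N))"
  unfolding cheb_node_def poly_chebyshev_T_cos by (simp add: mult_ac)

lemma cheb_interp_chebyshev_T_eq:
  assumes "N \<ge> 1" "n \<le> N"
  shows "cheb_interp_chebyshev_T N n x = poly (chebyshev_T n) x"
  unfolding cheb_interp_chebyshev_T_def poly_chebyshev_T_node
  by (rule cheb_interp_chebyshev[OF assms])

text \<open>By aliasing, the interpolant of \<open>T_n\<close> is itself some \<open>T_m\<close>
  with \<open>m \<le> N\<close>. This is what keeps the stability constant independent of
  \<open>N\<close>.\<close>

lemma abs_cheb_interp_chebyshev_T_le_1: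
  assumes N: "N \<ge> 1" and x: "x \<in> {-1..1}"
  shows "\<bar>cheb_interp_chebyshev_T N n x\<bar> \<le> 1"
proof -
  obtain m where m: "m \<le> N"
    "\<And>k. cos (real n * pi * (real k / real N)) = cos (real m * pi * (real k / real N))"
    using cheb_alias[OF N] by metis
  have "cheb_interp_chebyshev_T N n x = poly (chebyshev_T m) x"
    unfolding cheb_interp_chebyshev_T_def poly_chebyshev_T_node m(2)
    by (rule cheb_interp_chebyshev[OF N m(1)])
  then show ?thesis using abs_poly_chebyshev_T_le_1[OF x] by simp
qed


section \<open>Chebyshev series on Bernstein ellipses\<close>

text \<open>The Weierstrass M-test makes the convergence uniform on the circle, which permits
  termwise integration.\<close>

lemma contour_integral_circlepath_sums:
  fixes f :: "nat \<Rightarrow> complex \<Rightarrow> complex"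
  assumes r: "0 < r"
    and cont: "\<And>n. continuous_on (sphere z r) (f n)"
    and le: "\<And>n u. u \<in> sphere z r \<Longrightarrow> cmod (f n u) \<le> M n"
    and M: "summable M"
    and sums: "\<And>u. u \<in> sphere z r \<Longrightarrow> (\<lambda>n. f n u) sums F u"
  shows "(\<lambda>n. contour_integral (circlepath z r) (f n)) sums contour_integral (circlepath z r) F"
proof -
  have int: "f n contour_integrable_on circlepath z r" for n
    using r cont by (intro contour_integrable_continuous_circlepath) simp
  have "uniform_limit (sphere z r) (\<lambda>n u. \<Sum>i<n. f i u) (\<lambda>u. \<Sum>i. f i u) sequentially"
    by (rule Weierstrass_m_test[OF le M])
  then have lim: "uniform_limit (sphere z r) (\<lambda>n u. \<Sum>i<n. f i u) F sequentially"
    by (rule uniform_limit_cong'[THEN iffD1, rotated -1]) (use sums_unique[OF sums] in auto)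
  have "(\<lambda>n. contour_integral (circlepath z r) (\<lambda>u. \<Sum>i<n. f i u)) \<longlonglongrightarrow> contour_integral (circlepath z r) F"
    by (rule contour_integral_uniform_limit_circlepath)
      (use r lim int in \<open>auto intro!: contour_integrable_sum always_eventually\<close>)
  moreover have "contour_integral (circlepath z r) (\<lambda>u. \<Sum>i<n. f i u) =
      (\<Sum>i<n. contour_integral (circlepath z r) (f i))" for n
    using int by (intro contour_integral_sum) auto
  ultimately show ?thesis by (simp add: sums_def)
qed

text \<open>The straight-line homotopy is radial: for equal parameters the two points lie on one
  ray, so moduli stay between \<open>s1\<close> and \<open>s2\<close>.\<close>

lemma homotopic_loops_circlepath_annulus:
  assumes "R1 < s1" "s1 \<le> s2" "s2 < R2" "0 \<le> R1"
  shows "homotopic_loops {z::complex. R1 < cmod z \<and> cmod z < R2} (circlepath 0 s2) (circlepath 0 s1)"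
proof (rule homotopic_loops_linear)
  fix t :: real assume "t \<in> {0..1}"
  show "closed_segment (circlepath 0 s2 t) (circlepath 0 s1 t) \<subseteq> {z. R1 < cmod z \<and> cmod z < R2}"
  proof
    fix v assume "v \<in> closed_segment (circlepath 0 s2 t) (circlepath 0 s1 t)"
    then obtain a where a: "0 \<le> a" "a \<le> 1" and
      v: "v = (1 - a) *\<^sub>R circlepath 0 s2 t + a *\<^sub>R circlepath 0 s1 t"
      unfolding closed_segment_def by blast
    have "v = of_real ((1 - a) * s2 + a * s1) * exp (2 * of_real pi * \<i> * of_real t)"
      unfolding v circlepath by (simp add: scaleR_conv_of_real algebra_simps)
    then have "cmod v = \<bar>(1 - a) * s2 + a * s1\<bar>"
      by (simp only: norm_mult norm_of_real norm_exp_eq_Re) simp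
    moreover have "(1 - a) * s1 \<le> (1 - a) * s2" "a * s1 \<le> a * s2"
      using a assms by (auto intro: mult_left_mono)
    then have "s1 \<le> (1 - a) * s2 + a * s1" "(1 - a) * s2 + a * s1 \<le> s2"
      by (simp_all add: algebra_simps)
    ultimately show "v \<in> {z. R1 < cmod z \<and> cmod z < R2}" using assms by auto
  qed
qed auto

lemma open_annulus: "open {z::complex. R1 < cmod z \<and> cmod z < R2}"
  by (intro open_Collect_conj open_Collect_less continuous_intros)

text \<open>The difference quotient of \<open>g\<close> at \<open>w\<close> has a removable
  singularity, so it has equal integrals over both circles. What remains is the integral of
  \<open>g w / (u - w)\<close>, to which only the outer circle contributes because only it encloses
  \<open>w\<close>.\<close>

lemma Cauchy_integral_annulus:
  assumes g: "g holomorphic_on {z. R1 < cmod z \<and> cmod z < R2}"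
    and R: "0 \<le> R1" "R1 < s1" "s1 < cmod w" "cmod w < s2" "s2 < R2"
  shows "contour_integral (circlepath 0 s2) (\<lambda>u. g u / (u - w)) -
    contour_integral (circlepath 0 s1) (\<lambda>u. g u / (u - w)) = 2 * of_real pi * \<i> * g w"
proof -
  define A where "A = {z::complex. R1 < cmod z \<and> cmod z < R2}"
  define \<phi> where "\<phi> = (\<lambda>u. if u = w then deriv g w else (g u - g w) / (u - w))"
  have hol: "\<phi> holomorphic_on A"
    unfolding \<phi>_def using pole_lemma_open[OF g open_annulus] by (simp add: A_def)
  have eq: "contour_integral (circlepath 0 s2) \<phi> = contour_integral (circlepath 0 s1) \<phi>"
    by (rule Cauchy_theorem_homotopic_loops[OF homotopic_loops_circlepath_annulus[of R1 s1 s2 R2]])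
      (use R hol open_annulus in \<open>auto simp: A_def\<close>)
  have part: "contour_integral (circlepath 0 s) \<phi> =
      contour_integral (circlepath 0 s) (\<lambda>u. g u / (u - w)) -
      contour_integral (circlepath 0 s) (\<lambda>u. g w / (u - w))"
    if s: "R1 < s" "s < R2" "s \<noteq> cmod w" for s
  proof -
    have sub: "sphere 0 s \<subseteq> A" using s by (auto simp: A_def)
    have cg: "continuous_on (sphere 0 s) g"
      using holomorphic_on_imp_continuous_on[OF g] sub by (auto simp: A_def intro: continuous_on_subset)
    have s0: "0 \<le> s" using s R by simp
    have "contour_integral (circlepath 0 s) \<phi> =
        contour_integral (circlepath 0 s) (\<lambda>u. g u / (u - w) - g w / (u - w))"
      by (intro contour_integral_eq) (use s0 s in \<open>auto simp: \<phi>_def diff_divide_distrib\<close>)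
    also have "\<dots> = contour_integral (circlepath 0 s) (\<lambda>u. g u / (u - w)) -
      contour_integral (circlepath 0 s) (\<lambda>u. g w / (u - w))"
      by (intro contour_integral_diff contour_integrable_continuous_circlepath)
        (use s0 s cg in \<open>auto intro!: continuous_intros\<close>)
    finally show ?thesis .
  qed
  have outer: "contour_integral (circlepath 0 s2) (\<lambda>u. g w / (u - w)) = 2 * of_real pi * \<i> * g w"
    by (rule contour_integral_unique, rule Cauchy_integral_circlepath_simple) (use R in auto)
  \<comment> \<open>The inner circle lies in the disc of radius \<open>cmod w\<close>, where this
    kernel has no pole.\<close>
  have "((\<lambda>u. g w / (u - w)) has_contour_integral 0) (circlepath 0 s1)"
    by (rule Cauchy_theorem_convex_simple[of _ "ball 0 (cmod w)"])
      (use R in \<open>auto intro!: holomorphic_intros\<close>)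
  then have inner: "contour_integral (circlepath 0 s1) (\<lambda>u. g w / (u - w)) = 0"
    by (rule contour_integral_unique)
  show ?thesis using eq part[of s1] part[of s2] outer inner R by (simp add: algebra_simps)
qed

text \<open>The coefficients do not depend on \<open>w\<close>, which is what allows averaging over \<open>w\<close> and \<open>1 / w\<close>.\<close>

lemma Laurent_series_annulus:
  assumes g: "g holomorphic_on {z. R1 < cmod z \<and> cmod z < R2}"
    and R: "0 \<le> R1" "R1 < s1" "s1 < cmod w" "cmod w < s2" "s2 < R2"
  shows "(\<lambda>n. contour_integral (circlepath 0 s2) (\<lambda>u. g u / u ^ Suc n) / (2 * of_real pi * \<i>) * w ^ n +
     (if n = 0 then 0 else
        contour_integral (circlepath 0 s1) (\<lambda>u. g u * u ^ (n - 1)) / (2 * of_real pi * \<i>) / w ^ n))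
     sums g w"
proof -
  define A where "A = {z::complex. R1 < cmod z \<and> cmod z < R2}"
  have bdd: "\<exists>B. \<forall>u\<in>sphere 0 s. cmod (g u) \<le> B" and cont: "continuous_on (sphere 0 s) g"
    if s: "R1 < s" "s < R2" for s
  proof -
    have sub: "sphere 0 s \<subseteq> A" using s by (auto simp: A_def)
    show cg: "continuous_on (sphere 0 s) g"
      using holomorphic_on_imp_continuous_on[OF g] sub by (auto simp: A_def intro: continuous_on_subset)
    then have "compact (g ` sphere 0 s)" by (intro compact_continuous_image) auto
    then show "\<exists>B. \<forall>u\<in>sphere 0 s. cmod (g u) \<le> B"
      using compact_imp_bounded bounded_iff by (metis imageI)
  qed
  have s1: "R1 < s1" "s1 < R2" "0 < s1" and s2: "R1 < s2" "s2 < R2" "0 < s2" and w: "w \<noteq> 0"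
    using R by auto
  obtain B1 where B1: "\<And>u. cmod u = s1 \<Longrightarrow> cmod (g u) \<le> B1" using bdd[OF s1(1,2)] by (metis mem_sphere_0)
  obtain B2 where B2: "\<And>u. cmod u = s2 \<Longrightarrow> cmod (g u) \<le> B2" using bdd[OF s2(1,2)] by (metis mem_sphere_0)
  have geo: "(\<lambda>n. b * a ^ n) sums (b / (1 - a))" if "cmod a < 1" for a b :: complex
    using sums_mult[OF geometric_sums[OF that], of b] by simp
  \<comment> \<open>On the outer circle \<open>cmod w < cmod u\<close>, so the kernel is a geometric
    series in \<open>w / u\<close>.\<close>
  have "(\<lambda>n. contour_integral (circlepath 0 s2) (\<lambda>u. w ^ n * (g u / u ^ Suc n)))
      sums contour_integral (circlepath 0 s2) (\<lambda>u. g u / (u - w))"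
  proof (rule contour_integral_circlepath_sums[where M = "\<lambda>n. B2 / s2 * (cmod w / s2) ^ n"])
    show "continuous_on (sphere 0 s2) (\<lambda>u. w ^ n * (g u / u ^ Suc n))" for n
      using cont[OF s2(1,2)] s2 by (auto intro!: continuous_intros)
    show "cmod (w ^ n * (g u / u ^ Suc n)) \<le> B2 / s2 * (cmod w / s2) ^ n" if "u \<in> sphere 0 s2" for n u
    proof -
      have "cmod u = s2" using that by simp
      then show ?thesis using B2[of u] s2
        by (simp add: norm_mult norm_divide norm_power field_simps mult_right_mono)
    qed
    show "summable (\<lambda>n. B2 / s2 * (cmod w / s2) ^ n)"
      using R s2 by (intro summable_mult summable_geometric) simp
    show "(\<lambda>n. w ^ n * (g u / u ^ Suc n)) sums (g u / (u - w))" if "u \<in> sphere 0 s2" for u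
    proof -
      have u: "cmod u = s2" "u \<noteq> 0" "u \<noteq> w" using that s2 R by auto
      have "(\<lambda>n. g u / u * (w / u) ^ n) sums (g u / u / (1 - w / u))"
        by (rule geo) (use u R s2 in \<open>simp add: norm_divide\<close>)
      moreover have "g u / u / (1 - w / u) = g u / (u - w)" using u by (simp add: field_simps)
      ultimately have "(\<lambda>n. g u / u * (w / u) ^ n) sums (g u / (u - w))" by (simp only:)
      then show ?thesis by (simp add: power_divide mult_ac)
    qed
  qed (use s2 in simp)
  moreover have "contour_integral (circlepath 0 s2) (\<lambda>u. w ^ n * (g u / u ^ Suc n)) =
      contour_integral (circlepath 0 s2) (\<lambda>u. g u / u ^ Suc n) * w ^ n" for n
  proof -
    have "(\<lambda>u. g u / u ^ Suc n) contour_integrable_on circlepath 0 s2"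
      using cont[OF s2(1,2)] s2
      by (intro contour_integrable_continuous_circlepath) (auto intro!: continuous_intros)
    then show ?thesis by (subst contour_integral_lmul) (auto simp: mult.commute)
  qed
  ultimately have outer: "(\<lambda>n. contour_integral (circlepath 0 s2) (\<lambda>u. g u / u ^ Suc n) * w ^ n)
      sums contour_integral (circlepath 0 s2) (\<lambda>u. g u / (u - w))"
    by (simp only:)
  \<comment> \<open>On the inner circle the geometric series runs in \<open>u / w\<close> instead,
    which produces the minus sign.\<close>
  have inner0: "(\<lambda>n. contour_integral (circlepath 0 s1) (\<lambda>u. (- 1 / w ^ Suc n) * (g u * u ^ n)))
      sums contour_integral (circlepath 0 s1) (\<lambda>u. g u / (u - w))"
  proof (rule contour_integral_circlepath_sums[where M = "\<lambda>n. B1 / cmod w * (s1 / cmod w) ^ n"])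
    show "continuous_on (sphere 0 s1) (\<lambda>u. (- 1 / w ^ Suc n) * (g u * u ^ n))" for n
      using cont[OF s1(1,2)] by (intro continuous_intros) 
    show "cmod ((- 1 / w ^ Suc n) * (g u * u ^ n)) \<le> B1 / cmod w * (s1 / cmod w) ^ n"
      if "u \<in> sphere 0 s1" for n u
    proof -
      have "cmod u = s1" using that by simp
      then show ?thesis using B1[of u] s1 w
        by (simp add: norm_mult norm_divide norm_power divide_simps mult_right_mono)
    qed
    show "summable (\<lambda>n. B1 / cmod w * (s1 / cmod w) ^ n)"
      using R s1 w by (intro summable_mult summable_geometric) simp
    show "(\<lambda>n. (- 1 / w ^ Suc n) * (g u * u ^ n)) sums (g u / (u - w))" if "u \<in> sphere 0 s1" for u
    proof -
      have u: "cmod u = s1" "u \<noteq> w" using that s1 R by auto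
      have "(\<lambda>n. - g u / w * (u / w) ^ n) sums (- g u / w / (1 - u / w))"
        by (rule geo) (use u R s1 w in \<open>simp add: norm_divide\<close>)
      moreover have "- g u / w / (1 - u / w) = g u / (u - w)" using u w by (simp add: field_simps)
      ultimately have "(\<lambda>n. - g u / w * (u / w) ^ n) sums (g u / (u - w))" by (simp only:)
      then show ?thesis by (simp add: power_divide mult_ac)
    qed
  qed (use s1 in simp)
  have eq: "contour_integral (circlepath 0 s1) (\<lambda>u. (- 1 / w ^ Suc n) * (g u * u ^ n)) =
      - (contour_integral (circlepath 0 s1) (\<lambda>u. g u * u ^ n) / w ^ Suc n)" for n
  proof -
    have "(\<lambda>u. g u * u ^ n) contour_integrable_on circlepath 0 s1"
      using cont[OF s1(1,2)] s1
      by (intro contour_integrable_continuous_circlepath) (auto intro!: continuous_intros)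
    then show ?thesis by (subst contour_integral_lmul) auto
  qed
  \<comment> \<open>The inner series starts at the power -1 of \<open>w\<close>; the shift by one,
    with value 0 at \<open>n = 0\<close>, aligns it with the outer series.\<close>
  have "(\<lambda>n. if Suc n = 0 then 0 else
        contour_integral (circlepath 0 s1) (\<lambda>u. g u * u ^ (Suc n - 1)) / w ^ Suc n)
      sums - contour_integral (circlepath 0 s1) (\<lambda>u. g u / (u - w))"
    using sums_minus[OF inner0] unfolding eq by simp
  then have inner: "(\<lambda>n. if n = 0 then 0 else
        contour_integral (circlepath 0 s1) (\<lambda>u. g u * u ^ (n - 1)) / w ^ n)
      sums - contour_integral (circlepath 0 s1) (\<lambda>u. g u / (u - w))"
    by (subst (asm) sums_Suc_iff) simp
  have "(\<lambda>n. (contour_integral (circlepath 0 s2) (\<lambda>u. g u / u ^ Suc n) * w ^ n + (if n = 0 then 0 else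
        contour_integral (circlepath 0 s1) (\<lambda>u. g u * u ^ (n - 1)) / w ^ n)) / (2 * of_real pi * \<i>))
      sums ((2 * of_real pi * \<i> * g w) / (2 * of_real pi * \<i>))"
    using sums_divide[OF sums_add[OF outer inner], of "2 * of_real pi * \<i>"] Cauchy_integral_annulus[OF g R]
    by simp
  then show ?thesis
    by (auto elim!: back_subst[where P = "\<lambda>f. f sums _"] simp: fun_eq_iff add_divide_distrib)
qed

section \<open>From the annulus to the ellipse\<close>

text \<open>The distances to the foci add up to \<open>t + 1 / t\<close> with
  \<open>t = cmod w\<close>, and \<open>t + 1 / t < r + 1 / r\<close> amounts to
  \<open>(r - t) * (r * t - 1) > 0\<close>.\<close>

lemma joukowski_in_bernstein:
  assumes r: "1 < r" and w: "1 / r < cmod w" "cmod w < r"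
  shows "(w + inverse w) / 2 \<in> bernstein r"
proof -
  have c: "0 < cmod w" using r w by (metis divide_pos_pos less_trans zero_less_one)
  then have w0: "w \<noteq> 0" by auto
  have "(r - cmod w) * (r * cmod w - 1) > 0"
    using w r by (intro mult_pos_pos) (auto simp: field_simps)
  then have "cmod w + 1 / cmod w < r + 1 / r"
    using c r by (simp add: field_simps)
  then show ?thesis
    unfolding bernstein_def using joukowski_dist_foci[OF w0] by simp
qed

text \<open>Averaging the Laurent series of \<open>h \<circ> J\<close> over
  \<open>w = cis \<theta>\<close> and its inverse turns both \<open>w ^ n\<close> and
  \<open>1 / w ^ n\<close> into \<open>cos (n * \<theta>)\<close>, that is, into \<open>T_n\<close>
  at \<open>cos \<theta>\<close>. The circles have radii \<open>s\<close> and \<open>1 / s\<close>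
  with \<open>s < r\<close> because \<open>h\<close> is controlled only on the open ellipse.\<close>

lemma Chebyshev_series:
  assumes h: "h holomorphic_on bernstein r" and M: "\<And>z. z \<in> bernstein r \<Longrightarrow> cmod (h z) \<le> M"
    and s: "1 < s" "s < r"
  obtains a :: "nat \<Rightarrow> complex" where "\<And>n. cmod (a n) \<le> 2 * M * (1 / s) ^ n"
    "\<And>x. x \<in> {-1..1} \<Longrightarrow> (\<lambda>n. a n * of_real (poly (chebyshev_T n) x)) sums h (of_real x)"
proof -
  define A where "A = {z. 1 / r < cmod z \<and> cmod z < r}"
  define J where "J = (\<lambda>w::complex. (w + inverse w) / 2)"
  have JA: "J w \<in> bernstein r" if "w \<in> A" for w
    using that s joukowski_in_bernstein[of r w] by (simp add: A_def J_def)
  have A0: "w \<noteq> 0" if "w \<in> A" for w using that s by (auto simp: A_def)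
  have "J holomorphic_on A" unfolding J_def by (intro holomorphic_intros) (use A0 in auto)
  then have "(h \<circ> J) holomorphic_on A"
    by (rule holomorphic_on_compose_gen[OF _ h]) (use JA in auto)
  then have hol: "(\<lambda>w. h (J w)) holomorphic_on {z. 1 / r < cmod z \<and> cmod z < r}"
    by (simp add: o_def A_def)
  have cA: "w \<in> A" if "cmod w = s \<or> cmod w = 1 / s" for w
  proof -
    have "1 / s < 1" using s by simp
    moreover have "1 / r < 1" using s by simp
    moreover have "1 / r < 1 / s" using s by (simp add: frac_less2)
    ultimately show ?thesis using that s unfolding A_def mem_Collect_eq by linarith
  qed
  have cg: "continuous_on (sphere 0 t) (\<lambda>w. h (J w))" if "t = s \<or> t = 1 / s" for t
    using holomorphic_on_imp_continuous_on[OF hol] 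
    by (rule continuous_on_subset) (use that cA in \<open>auto simp: A_def[symmetric]\<close>)
  define b where "b n = contour_integral (circlepath 0 s) (\<lambda>u. h (J u) / u ^ Suc n) / (2 * of_real pi * \<i>)" for n
  \<comment> \<open>The value 0 at \<open>n = 0\<close> leaves the constant Laurent term to
    \<open>b 0\<close> alone.\<close>
  define d where "d n = (if n = 0 then 0 else
     contour_integral (circlepath 0 (1 / s)) (\<lambda>u. h (J u) * u ^ (n - 1)) / (2 * of_real pi * \<i>))" for n :: nat
  have "cmod (h (J (of_real s))) \<le> M" by (intro M JA cA) (use s in auto)
  then have M0: "0 \<le> M" using norm_ge_zero order_trans by blast
  have b: "cmod (b n) \<le> M * (1 / s) ^ n" for n
  proof -
    have "cmod (contour_integral (circlepath 0 s) (\<lambda>u. h (J u) / u ^ Suc n)) \<le> M / s ^ Suc n * (2 * pi * s)"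
    proof (rule has_contour_integral_bound_circlepath)
      show "((\<lambda>u. h (J u) / u ^ Suc n) has_contour_integral
          contour_integral (circlepath 0 s) (\<lambda>u. h (J u) / u ^ Suc n)) (circlepath 0 s)"
        using cg[of s] s
        by (intro has_contour_integral_integral contour_integrable_continuous_circlepath)
          (auto intro!: continuous_intros)
      show "cmod (h (J u) / u ^ Suc n) \<le> M / s ^ Suc n" if "cmod (u - 0) = s" for u
        using that s M[OF JA[OF cA[of u]]] by (simp add: norm_divide norm_mult norm_power divide_right_mono)
    qed (use s M0 in auto)
    then show ?thesis using s by (simp add: b_def norm_divide norm_mult power_divide field_simps)
  qed
  have d: "cmod (d n) \<le> M * (1 / s) ^ n" for n
  proof (cases n)
    case 0
    then show ?thesis using M0 by (simp add: d_def)
  next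
    case (Suc m)
    have "cmod (contour_integral (circlepath 0 (1 / s)) (\<lambda>u. h (J u) * u ^ m)) \<le> M * (1 / s) ^ m * (2 * pi * (1 / s))"
    proof (rule has_contour_integral_bound_circlepath)
      show "((\<lambda>u. h (J u) * u ^ m) has_contour_integral
          contour_integral (circlepath 0 (1 / s)) (\<lambda>u. h (J u) * u ^ m)) (circlepath 0 (1 / s))"
        using cg[of "1 / s"] s
        by (intro has_contour_integral_integral contour_integrable_continuous_circlepath)
          (auto intro!: continuous_intros)
      show "cmod (h (J u) * u ^ m) \<le> M * (1 / s) ^ m" if "cmod (u - 0) = 1 / s" for u
        using that s M[OF JA[OF cA[of u]]] by (simp add: norm_mult norm_power mult_right_mono)
    qed (use s M0 in auto)
    then show ?thesis using s Suc by (simp add: d_def norm_divide norm_mult power_divide field_simps)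
  qed
  have L: "(\<lambda>n. b n * w ^ n + d n / w ^ n) sums h (J w)" if "cmod w = 1" for w
  proof -
    have "0 \<le> 1 / r" "1 / r < 1 / s" "1 / s < cmod w" "cmod w < s" "s < r"
      using that s by (auto simp: frac_less2)
    from Laurent_series_annulus[OF hol this] show ?thesis
      by (auto elim!: back_subst[where P = "\<lambda>f. f sums _"] simp: fun_eq_iff b_def d_def)
  qed
  show thesis
  proof (rule that)
    show "cmod (b n + d n) \<le> 2 * M * (1 / s) ^ n" for n
      using norm_triangle_ineq[of "b n" "d n"] b[of n] d[of n] by simp
    fix x :: real assume x: "x \<in> {-1..1}"
    define \<theta> where "\<theta> = arccos x"
    have xc: "x = cos \<theta>" using x by (simp add: \<theta>_def cos_arccos)
    have Jc: "J (cis t) = of_real (cos t)" for t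
      by (simp add: J_def cis_inverse complex_eq_iff)
    \<comment> \<open>\<open>J\<close> sends \<open>cis \<theta>\<close> and
      \<open>cis (-\<theta>)\<close> to the same point \<open>x\<close>, so the averaged limit is
      \<open>h x\<close>.\<close>
    have "(\<lambda>n. ((b n * cis \<theta> ^ n + d n / cis \<theta> ^ n) + (b n * cis (-\<theta>) ^ n + d n / cis (-\<theta>) ^ n)) / 2) sums
        ((h (J (cis \<theta>)) + h (J (cis (-\<theta>)))) / 2)"
      by (intro sums_divide sums_add L) auto
    moreover have "((b n * cis \<theta> ^ n + d n / cis \<theta> ^ n) + (b n * cis (-\<theta>) ^ n + d n / cis (-\<theta>) ^ n)) / 2 =
        (b n + d n) * of_real (poly (chebyshev_T n) x)" for n
    proof -
      have i: "d / cis t = d * cis (- t)" for d t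
        by (simp add: divide_inverse cis_inverse)
      have "of_real (cos (real n * \<theta>)) = (cis (real n * \<theta>) + cis (- (real n * \<theta>))) / 2"
        by (simp add: complex_eq_iff)
      then show ?thesis unfolding xc poly_chebyshev_T_cos Complex.DeMoivre i
        by (simp add: field_simps)
    qed
    ultimately show "(\<lambda>n. (b n + d n) * of_real (poly (chebyshev_T n) x)) sums h (of_real x)"
      by (simp add: Jc xc)
  qed
qed


section \<open>One-dimensional error bounds\<close>

lemma norm_sums_le:
  fixes f :: "nat \<Rightarrow> 'a::banach"
  assumes "f sums F" "g sums G" "\<And>n. norm (f n) \<le> g n"
  shows "norm F \<le> G"
  using norm_suminf_le[of f g] assms by (auto simp: sums_iff)

text \<open>Serves to carry estimates proved for every \<open>s < r\<close> over to
  \<open>s = r\<close>.\<close>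

lemma le_limit_from_left:
  fixes \<phi> :: "real \<Rightarrow> real"
  assumes "1 < r" and le: "\<And>s. 1 < s \<Longrightarrow> s < r \<Longrightarrow> c \<le> \<phi> s" and "isCont \<phi> r"
  shows "c \<le> \<phi> r"
proof (rule tendsto_lowerbound)
  show "(\<phi> \<longlongrightarrow> \<phi> r) (at_left r)"
    using assms(3) by (simp add: isCont_def filterlim_at_split)
  show "\<forall>\<^sub>F s in at_left r. c \<le> \<phi> s"
    using assms(1) le by (intro eventually_at_leftI[of 1]) auto
qed simp

text \<open>The Chebyshev series is interpolated term by term. Terms of degree at most
  \<open>N\<close> are reproduced; each later one contributes at most twice its coefficient to the
  error, and every term at most its coefficient to the interpolant. Summing geometric series gives
  both bounds.\<close>

lemma Chebyshev_interp_bounds_aux: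
  assumes h: "h holomorphic_on bernstein r" and M: "\<And>z. z \<in> bernstein r \<Longrightarrow> cmod (h z) \<le> M"
    and s: "1 < s" "s < r" and N: "N \<ge> 1" and x: "x \<in> {-1..1}"
  defines "I \<equiv> \<Sum>k\<le>N. of_real (cheb_lagrange N k x) * h (of_real (cheb_node N k))"
  shows "cmod (h (of_real x) - I) \<le> 4 * M * ((1 / s) ^ N / (s - 1))" and "cmod I \<le> 2 * M / (1 - 1 / s)"
proof -
  define q where "q = 1 / s"
  have q: "0 < q" "q < 1" using s by (auto simp: q_def)
  obtain a :: "nat \<Rightarrow> complex" where a: "\<And>n. cmod (a n) \<le> 2 * M * q ^ n"
    and sums: "\<And>x. x \<in> {-1..1} \<Longrightarrow> (\<lambda>n. a n * of_real (poly (chebyshev_T n) x)) sums h (of_real x)"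
    unfolding q_def using Chebyshev_series[OF h M s] by metis
  have a0: "0 \<le> 2 * M * q ^ n" for n using a[of n] norm_ge_zero order_trans by blast
  have node: "cheb_node N k \<in> {-1..1}" for k by (simp add: cheb_node_def)
  have "(\<lambda>n. \<Sum>k\<le>N. of_real (cheb_lagrange N k x) * (a n * of_real (poly (chebyshev_T n) (cheb_node N k)))) sums I"
    unfolding I_def by (intro sums_sum sums_mult sums node)
  moreover have "(\<Sum>k\<le>N. of_real (cheb_lagrange N k x) * (a n * of_real (poly (chebyshev_T n) (cheb_node N k)))) =
      a n * of_real (cheb_interp_chebyshev_T N n x)" for n
    by (simp add: cheb_interp_chebyshev_T_def sum_distrib_left mult_ac)
  ultimately have I: "(\<lambda>n. a n * of_real (cheb_interp_chebyshev_T N n x)) sums I" by (simp only:)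
  have geo: "(\<lambda>n. c * q ^ n) sums (c / (1 - q))" for c
    using sums_mult[OF geometric_sums[of q], of c] q by simp
  show "cmod I \<le> 2 * M / (1 - 1 / s)"
    unfolding q_def[symmetric]
  proof (rule norm_sums_le[OF I geo])
    fix n
    have "cmod (a n) * \<bar>cheb_interp_chebyshev_T N n x\<bar> \<le> (2 * M * q ^ n) * 1"
      using a a0 abs_cheb_interp_chebyshev_T_le_1[OF N x] by (intro mult_mono) auto
    then show "cmod (a n * of_real (cheb_interp_chebyshev_T N n x)) \<le> 2 * M * q ^ n"
      by (simp add: norm_mult)
  qed
  \<comment> \<open>The majorant of the error series: zero up to degree \<open>N\<close>, then the
    coefficient bound \<open>2 * M * q ^ n\<close> times 2.\<close>
  define g where "g n = (if n < Suc N then 0 else 4 * M * q ^ n)" for n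
  have "(\<lambda>n. g (n + Suc N)) sums (4 * M * q ^ Suc N / (1 - q))"
    using geo[of "4 * M * q ^ Suc N"] by (simp add: g_def power_add mult_ac)
  moreover have "(\<Sum>n<Suc N. g n) = 0" by (intro sum.neutral) (simp add: g_def)
  ultimately have g: "g sums (4 * M * q ^ Suc N / (1 - q))"
    using sums_iff_shift[of g "Suc N"] by simp
  have "cmod (h (of_real x) - I) \<le> 4 * M * q ^ Suc N / (1 - q)"
  proof (rule norm_sums_le[OF sums_diff[OF sums[OF x] I] g])
    fix n
    define t where "t = poly (chebyshev_T n) x - cheb_interp_chebyshev_T N n x"
    have t: "a n * of_real (poly (chebyshev_T n) x) - a n * of_real (cheb_interp_chebyshev_T N n x) = a n * of_real t"
      by (simp add: t_def algebra_simps)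
    show "cmod (a n * of_real (poly (chebyshev_T n) x) - a n * of_real (cheb_interp_chebyshev_T N n x)) \<le> g n"
    proof (cases "n \<le> N")
      case True
      then show ?thesis using cheb_interp_chebyshev_T_eq[OF N True] by (simp add: g_def)
    next
      case False
      have "\<bar>t\<bar> \<le> 2"
        using abs_cheb_interp_chebyshev_T_le_1[OF N x, of n] abs_poly_chebyshev_T_le_1[OF x, of n]
        unfolding t_def by linarith
      then have "cmod (a n) * \<bar>t\<bar> \<le> (2 * M * q ^ n) * 2"
        using a a0 by (intro mult_mono) auto
      then show ?thesis using False unfolding t by (simp add: norm_mult g_def)
    qed
  qed
  moreover have "4 * M * q ^ Suc N / (1 - q) = 4 * M * ((1 / s) ^ N / (s - 1))"
  proof -
    have "q / (1 - q) = 1 / (s - 1)" using s by (simp add: q_def field_simps)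
    then have "4 * M * q ^ N * (q / (1 - q)) = 4 * M * q ^ N * (1 / (s - 1))" by simp
    then show ?thesis by (simp add: q_def mult_ac)
  qed
  ultimately show "cmod (h (of_real x) - I) \<le> 4 * M * ((1 / s) ^ N / (s - 1))" by simp
qed

text \<open>Both preceding bounds are continuous in \<open>s\<close> at \<open>r\<close>, so
  \<open>s\<close> may tend to \<open>r\<close> from below.\<close>

lemma
  assumes h: "h holomorphic_on bernstein r" and M: "\<And>z. z \<in> bernstein r \<Longrightarrow> cmod (h z) \<le> M"
    and r: "1 < r" and N: "N \<ge> 1" and x: "x \<in> {-1..1}"
  defines "I \<equiv> \<Sum>k\<le>N. of_real (cheb_lagrange N k x) * h (of_real (cheb_node N k))"
  shows Chebyshev_interp_error: "cmod (h (of_real x) - I) \<le> 4 * M * ((1 / r) ^ N / (r - 1))"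
    and Chebyshev_interp_bound: "cmod I \<le> 2 * M / (1 - 1 / r)"
proof -
  show "cmod (h (of_real x) - I) \<le> 4 * M * ((1 / r) ^ N / (r - 1))"
    unfolding I_def using r
    by (rule le_limit_from_left[where \<phi> = "\<lambda>s. 4 * M * ((1 / s) ^ N / (s - 1))"])
      (use r Chebyshev_interp_bounds_aux(1)[OF h M _ _ N x] in \<open>auto intro!: continuous_intros\<close>)
  show "cmod I \<le> 2 * M / (1 - 1 / r)"
    unfolding I_def using r
    by (rule le_limit_from_left[where \<phi> = "\<lambda>s. 2 * M / (1 - 1 / s)"])
      (use r Chebyshev_interp_bounds_aux(2)[OF h M _ _ N x] in \<open>auto intro!: continuous_intros\<close>)
qed


section \<open>Interpolation in a subset of the coordinates\<close>

text \<open>The weights \<open>w\<close> already contain the evaluation point in the coordinates of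
  \<open>S\<close>; outside \<open>S\<close> the point \<open>z\<close> is kept. Points are
  functions rather than vectors so that a coordinate can be changed by function update.\<close>

definition partial_interp ::
  "('n \<Rightarrow> nat) \<Rightarrow> ('n \<Rightarrow> nat \<Rightarrow> complex) \<Rightarrow> ('n \<Rightarrow> nat \<Rightarrow> complex) \<Rightarrow> 'n set \<Rightarrow>
     (('n \<Rightarrow> complex) \<Rightarrow> complex) \<Rightarrow> ('n \<Rightarrow> complex) \<Rightarrow> complex" where
  "partial_interp N w \<nu> S G z =
     (\<Sum>k\<in>Pi\<^sub>E S (\<lambda>i. {..N i}). (\<Prod>i\<in>S. w i (k i)) * G (\<lambda>i. if i \<in> S then \<nu> i (k i) else z i))"

lemma partial_interp_empty [simp]: "partial_interp N w \<nu> {} G z = G z"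
  by (simp add: partial_interp_def)

lemma sum_PiE_insert:
  fixes g :: "('a \<Rightarrow> 'b) \<Rightarrow> 'c::comm_monoid_add"
  assumes "i \<notin> S"
  shows "(\<Sum>k\<in>Pi\<^sub>E (insert i S) B. g k) = (\<Sum>y\<in>B i. \<Sum>k\<in>Pi\<^sub>E S B. g (k(i := y)))"
proof -
  have "(\<Sum>k\<in>Pi\<^sub>E (insert i S) B. g k) = (\<Sum>(y, k)\<in>B i \<times> Pi\<^sub>E S B. g (k(i := y)))"
    unfolding PiE_insert_eq
    by (subst sum.reindex) (auto simp: o_def inj_combinator[OF assms] intro!: sum.cong)
  also have "\<dots> = (\<Sum>y\<in>B i. \<Sum>k\<in>Pi\<^sub>E S B. g (k(i := y)))"
    by (rule sum.cartesian_product[symmetric])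
  finally show ?thesis .
qed

text \<open>Coordinate \<open>i\<close> can be split off as the outermost or as the innermost sum.
  The first form drives the induction for the norm bound, the second exposes a one-dimensional error
  inside a partial interpolant.\<close>

lemma
  assumes "i \<notin> S" "finite S"
  shows partial_interp_insert: "partial_interp N w \<nu> (insert i S) G z =
      (\<Sum>k\<le>N i. w i k * partial_interp N w \<nu> S G (z(i := \<nu> i k)))" (is ?A)
    and partial_interp_insert': "partial_interp N w \<nu> (insert i S) G z =
      partial_interp N w \<nu> S (\<lambda>z. \<Sum>k\<le>N i. w i k * G (z(i := \<nu> i k))) z" (is ?B)
proof -
  have prod: "(\<Prod>j\<in>insert i S. w j ((k(i := y)) j)) = w i y * (\<Prod>j\<in>S. w j (k j))" for k y
  proof -
    have "(\<Prod>j\<in>S. w j ((k(i := y)) j)) = (\<Prod>j\<in>S. w j (k j))"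
      using assms by (intro prod.cong) auto
    then show ?thesis using assms by simp
  qed
  have arg: "(\<lambda>j. if j \<in> insert i S then \<nu> j ((k(i := y)) j) else z j) =
        (\<lambda>j. if j \<in> S then \<nu> j (k j) else (z(i := \<nu> i y)) j)"
    and arg': "(\<lambda>j. if j \<in> insert i S then \<nu> j ((k(i := y)) j) else z j) =
        (\<lambda>j. if j \<in> S then \<nu> j (k j) else z j)(i := \<nu> i y)" for k y
    using assms by (auto simp: fun_eq_iff)
  show ?A
    unfolding partial_interp_def sum_PiE_insert[OF assms(1)] prod arg
    by (simp add: sum_distrib_left mult_ac)
  show ?B
    unfolding partial_interp_def sum_PiE_insert[OF assms(1)] prod arg'
    by (subst sum.swap) (simp add: sum_distrib_left mult_ac)
qed

lemma partial_interp_diff: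
  "partial_interp N w \<nu> S (\<lambda>z. G z - H z) z = partial_interp N w \<nu> S G z - partial_interp N w \<nu> S H z"
  by (simp add: partial_interp_def right_diff_distrib sum_subtractf)

section \<open>Stability and telescoping for separately holomorphic functions\<close>

definition separately_holomorphic_on ::
  "(('n \<Rightarrow> complex) \<Rightarrow> complex) \<Rightarrow> ('n \<Rightarrow> complex set) \<Rightarrow> bool" (infix "separately'_holomorphic'_on" 50) where
  "G separately_holomorphic_on E \<longleftrightarrow>
     (\<forall>z\<in>Pi UNIV E. \<forall>i. (\<lambda>t. G (z(i := t))) holomorphic_on E i)"

lemma separately_holomorphic_onD:
  "G separately_holomorphic_on E \<Longrightarrow> (\<And>i. z i \<in> E i) \<Longrightarrow> (\<lambda>t. G (z(i := t))) holomorphic_on E i"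
  by (auto simp: separately_holomorphic_on_def)

lemma separately_holomorphic_on_fix:
  assumes G: "G separately_holomorphic_on E" and v: "v \<in> E i"
  shows "(\<lambda>z. G (z(i := v))) separately_holomorphic_on E"
  unfolding separately_holomorphic_on_def
proof safe
  fix z j assume z: "z \<in> Pi UNIV E"
  show "(\<lambda>t. G ((z(j := t))(i := v))) holomorphic_on E j"
  proof (cases "j = i")
    case True
    then show ?thesis by simp
  next
    case False
    then have "(\<lambda>t. G ((z(j := t))(i := v))) = (\<lambda>t. G ((z(i := v))(j := t)))"
      by (simp add: fun_upd_twist)
    then show ?thesis using separately_holomorphic_onD[OF G, of "z(i := v)" j] z v by (auto simp: Pi_iff)
  qed
qed

text \<open>As \<open>i\<close> lies outside \<open>S\<close>, changing coordinate \<open>i\<close>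
  commutes with inserting the nodes, which leaves a finite sum of slices of
  \<open>G\<close>.\<close>

lemma holomorphic_on_partial_interp:
  assumes G: "G separately_holomorphic_on E" and \<nu>: "\<And>i k. \<nu> i k \<in> E i"
    and z: "\<And>i. z i \<in> E i" and i: "i \<notin> S"
  shows "(\<lambda>t. partial_interp N w \<nu> S G (z(i := t))) holomorphic_on E i"
proof -
  have "(\<lambda>j. if j \<in> S then \<nu> j (k j) else (z(i := t)) j) = (\<lambda>j. if j \<in> S then \<nu> j (k j) else z j)(i := t)" for k t
    using i by (auto simp: fun_eq_iff)
  then show ?thesis unfolding partial_interp_def
    by (simp only:) (intro holomorphic_intros separately_holomorphic_onD[OF G], use z \<nu> in auto)
qed

text \<open>By induction the partial interpolant over \<open>S\<close> is a holomorphic function of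
  the new coordinate with a uniform bound, so the one-dimensional stability estimate
  \<open>C\<close> costs one more factor.\<close>

lemma norm_partial_interp_le:
  assumes S: "finite S" and G: "G separately_holomorphic_on E" and \<nu>: "\<And>i k. \<nu> i k \<in> E i"
    and M: "\<And>z. (\<And>i. z i \<in> E i) \<Longrightarrow> cmod (G z) \<le> M"
    and C: "\<And>i h M. h holomorphic_on E i \<Longrightarrow> (\<And>t. t \<in> E i \<Longrightarrow> cmod (h t) \<le> M) \<Longrightarrow>
      cmod (\<Sum>k\<le>N i. w i k * h (\<nu> i k)) \<le> C i * M"
    and z: "\<And>i. z i \<in> E i"
  shows "cmod (partial_interp N w \<nu> S G z) \<le> (\<Prod>i\<in>S. C i) * M"
  using S z
proof (induction S arbitrary: z rule: finite_induct)
  case empty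
  then show ?case using M by simp
next
  case (insert i S)
  have "cmod (\<Sum>k\<le>N i. w i k * partial_interp N w \<nu> S G (z(i := \<nu> i k))) \<le> C i * ((\<Prod>i\<in>S. C i) * M)"
    by (rule C[OF holomorphic_on_partial_interp[OF G \<nu> insert.prems]])
      (use insert in auto)
  then show ?case using insert by (simp add: partial_interp_insert mult_ac)
qed

text \<open>Telescoping over the coordinates: the one-dimensional error in coordinate \<open>b k\<close> is a bounded
  separately holomorphic function of the coordinates interpolated before it.\<close>

lemma norm_partial_interp_error_le:
  fixes b :: "nat \<Rightarrow> 'n" and c :: "'n \<Rightarrow> real"
  assumes b: "inj_on b {1..n}"
    and G: "G separately_holomorphic_on E" and \<nu>: "\<And>i k. \<nu> i k \<in> E i"
    and M: "\<And>z. (\<And>i. z i \<in> E i) \<Longrightarrow> cmod (G z) \<le> M"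
    and C: "\<And>i h M. h holomorphic_on E i \<Longrightarrow> (\<And>t. t \<in> E i \<Longrightarrow> cmod (h t) \<le> M) \<Longrightarrow>
      cmod (\<Sum>k\<le>N i. w i k * h (\<nu> i k)) \<le> C i * M"
    and c: "\<And>i h M. h holomorphic_on E i \<Longrightarrow> (\<And>t. t \<in> E i \<Longrightarrow> cmod (h t) \<le> M) \<Longrightarrow>
      cmod (h (x i) - (\<Sum>k\<le>N i. w i k * h (\<nu> i k))) \<le> c i * M"
    and x: "\<And>i. x i \<in> E i"
  shows "cmod (G x - partial_interp N w \<nu> (b ` {1..n}) G x) \<le>
    (\<Sum>k=1..n. (\<Prod>j=1..k - 1. C (b j)) * (c (b k) * M))"
  using b
proof (induction n)
  case 0
  then show ?case by simp
next
  case (Suc n)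
  define S where "S = b ` {1..n}"
  define i where "i = b (Suc n)"
  have inj: "inj_on b {1..n}" using Suc.prems by (rule inj_on_subset) auto
  have "{1..Suc n} = insert (Suc n) {1..n}" by auto
  then have S': "b ` {1..Suc n} = insert i S" by (simp add: S_def i_def)
  have i: "i \<notin> S" "finite S"
    using Suc.prems unfolding S_def i_def by (fastforce simp: inj_on_def)+
  \<comment> \<open>The one-dimensional error in coordinate \<open>i\<close>, evaluated at
    \<open>x i\<close>, as a function of the other coordinates.\<close>
  define R where "R = (\<lambda>z. G (z(i := x i)) - (\<Sum>k\<le>N i. w i k * G (z(i := \<nu> i k))))"
  have R: "R separately_holomorphic_on E"
    using separately_holomorphic_on_fix[OF G x] separately_holomorphic_on_fix[OF G \<nu>]
    unfolding R_def separately_holomorphic_on_def by (auto intro!: holomorphic_intros)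
  have "partial_interp N w \<nu> S R x = partial_interp N w \<nu> S (\<lambda>z. G (z(i := x i))) x
      - partial_interp N w \<nu> (insert i S) G x"
    unfolding R_def partial_interp_diff partial_interp_insert'[OF i] ..
  \<comment> \<open>Coordinate \<open>i\<close> of \<open>x\<close> already is \<open>x i\<close>;
    hence interpolating \<open>R\<close> over \<open>S\<close> gives exactly one telescoping
    difference.\<close>
  moreover have "partial_interp N w \<nu> S (\<lambda>z. G (z(i := x i))) x = partial_interp N w \<nu> S G x"
  proof -
    have "(\<lambda>j. if j \<in> S then \<nu> j (k j) else x j)(i := x i) = (\<lambda>j. if j \<in> S then \<nu> j (k j) else x j)" for k
      using i by (auto simp: fun_eq_iff)
    then show ?thesis unfolding partial_interp_def by (simp only:)
  qed
  moreover have "cmod (partial_interp N w \<nu> S R x) \<le> (\<Prod>j\<in>S. C j) * (c i * M)"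
  proof (rule norm_partial_interp_le[OF i(2) R, where \<nu> = \<nu> and C = C])
    fix z assume z: "\<And>i. z i \<in> E i"
    show "cmod (R z) \<le> c i * M"
      unfolding R_def
      by (rule c[of "\<lambda>t. G (z(i := t))"]) (use z in \<open>auto intro!: separately_holomorphic_onD[OF G] M\<close>)
  qed (use \<nu> C x in auto)
  moreover have "(\<Prod>j\<in>S. C j) = (\<Prod>j=1..n. C (b j))"
    unfolding S_def by (rule prod.reindex_cong[OF inj]) auto
  moreover have "cmod (G x - partial_interp N w \<nu> S G x) \<le>
      (\<Sum>k=1..n. (\<Prod>j=1..k - 1. C (b j)) * (c (b k) * M))"
    unfolding S_def by (rule Suc.IH[OF inj])
  moreover have "cmod (G x - partial_interp N w \<nu> (insert i S) G x) \<le>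
      cmod (G x - partial_interp N w \<nu> S G x) +
      cmod (partial_interp N w \<nu> S G x - partial_interp N w \<nu> (insert i S) G x)"
    by (metis norm_triangle_ineq add_diff_eq diff_add_cancel)
  ultimately show ?case unfolding S' by (simp add: i_def)
qed


section \<open>Separate holomorphy and continuity\<close>

text \<open>On the line through \<open>a\<close> in direction \<open>i\<close> all monomials that
  involve another coordinate vanish, so the expansion becomes a power series in one
  variable.\<close>

lemma exists_ball_slice_holomorphic:
  fixes F :: "complex ^ 'n::finite \<Rightarrow> complex"
  assumes F: "mv_analytic_on F S" and a: "a \<in> S"
  shows "\<exists>\<epsilon>>0. (\<lambda>t. F (\<chi> j. if j = i then t else a $ j)) holomorphic_on ball (a $ i) \<epsilon>"
proof -
  obtain c :: "('n \<Rightarrow> nat) \<Rightarrow> complex" and \<epsilon> where \<epsilon>: "\<epsilon> > 0"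
    and ps: "\<And>z. (\<forall>i. cmod (z $ i - a $ i) < \<epsilon>) \<Longrightarrow>
        ((\<lambda>\<alpha>. c \<alpha> * (\<Prod>i\<in>UNIV. (z $ i - a $ i) ^ \<alpha> i)) has_sum F z) UNIV"
    using bspec[OF F[unfolded mv_analytic_on_def] a] by blast
  \<comment> \<open>The multi-index with \<open>n\<close> at \<open>i\<close> and 0
    elsewhere.\<close>
  define \<alpha> where "\<alpha> n = (\<lambda>j. if j = i then n else 0)" for n :: nat
  have inj: "inj \<alpha>" by (auto simp: inj_def \<alpha>_def fun_eq_iff)
  have "(\<lambda>t. F (\<chi> j. if j = i then t else a $ j)) holomorphic_on ball (a $ i) \<epsilon>"
  proof (rule power_series_holomorphic)
    fix t assume t: "t \<in> ball (a $ i) \<epsilon>"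
    define z where "z = (\<chi> j. if j = i then t else a $ j)"
    have zero: "c \<beta> * (\<Prod>j\<in>UNIV. (z $ j - a $ j) ^ \<beta> j) = 0" if "\<beta> \<notin> range \<alpha>" for \<beta>
    proof -
      have "\<exists>j. j \<noteq> i \<and> \<beta> j \<noteq> 0"
      proof (rule ccontr)
        assume "\<not> ?thesis"
        then have "\<beta> = \<alpha> (\<beta> i)" by (auto simp: \<alpha>_def fun_eq_iff)
        then show False using that by auto
      qed
      then obtain j where "j \<noteq> i" "\<beta> j \<noteq> 0" by blast
      then have "(z $ j - a $ j) ^ \<beta> j = 0" by (simp add: z_def)
      then have "(\<Prod>j\<in>UNIV. (z $ j - a $ j) ^ \<beta> j) = 0" by (intro prod_zero) auto
      then show ?thesis by simp
    qed
    have val: "(\<Prod>j\<in>UNIV. (z $ j - a $ j) ^ \<alpha> n j) = (t - a $ i) ^ n" for n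
    proof -
      have "(\<Prod>j\<in>UNIV. (z $ j - a $ j) ^ \<alpha> n j) = (\<Prod>j\<in>UNIV. if j = i then (t - a $ i) ^ n else 1)"
        by (intro prod.cong) (auto simp: \<alpha>_def z_def)
      then show ?thesis by simp
    qed
    have "((\<lambda>\<beta>. c \<beta> * (\<Prod>j\<in>UNIV. (z $ j - a $ j) ^ \<beta> j)) has_sum F z) UNIV"
      by (rule ps) (use t \<epsilon> in \<open>auto simp: z_def dist_norm norm_minus_commute\<close>)
    then have "((\<lambda>\<beta>. c \<beta> * (\<Prod>j\<in>UNIV. (z $ j - a $ j) ^ \<beta> j)) has_sum F z) (range \<alpha>)"
      by (subst has_sum_cong_neutral[where T = UNIV and g = "\<lambda>\<beta>. c \<beta> * (\<Prod>j\<in>UNIV. (z $ j - a $ j) ^ \<beta> j)"])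
        (use zero in auto)
    then have "((\<lambda>n. c (\<alpha> n) * (t - a $ i) ^ n) has_sum F z) UNIV"
      by (subst (asm) has_sum_reindex[OF inj]) (simp add: o_def val)
    then show "(\<lambda>n. c (\<alpha> n) * (t - a $ i) ^ n) sums F z"
      by (rule has_sum_imp_sums)
  qed
  then show ?thesis using \<epsilon> by blast
qed

text \<open>Absolute convergence at one corner of a polydisc dominates the series inside it.
  Shrinking the polydisc by \<open>q\<close> gains a factor \<open>q\<close> on every nonconstant
  monomial, so \<open>F z - F a\<close> is at most \<open>q * K\<close>.\<close>

lemma isCont_mv_analytic:
  fixes F :: "complex ^ 'n::finite \<Rightarrow> complex"
  assumes F: "mv_analytic_on F S" and a: "a \<in> S"
  shows "isCont F a"
proof -
  obtain c :: "('n \<Rightarrow> nat) \<Rightarrow> complex" and \<epsilon> where \<epsilon>: "\<epsilon> > 0"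
    and ps: "\<And>z. (\<forall>i. cmod (z $ i - a $ i) < \<epsilon>) \<Longrightarrow>
        ((\<lambda>\<alpha>. c \<alpha> * (\<Prod>i\<in>UNIV. (z $ i - a $ i) ^ \<alpha> i)) has_sum F z) UNIV"
    using bspec[OF F[unfolded mv_analytic_on_def] a] by blast
  define \<delta> where "\<delta> = \<epsilon> / 2"
  have \<delta>: "0 < \<delta>" "\<delta> < \<epsilon>" using \<epsilon> by (auto simp: \<delta>_def)
  define p where "p z \<alpha> = (\<Prod>i\<in>UNIV. (z $ i - a $ i) ^ \<alpha> i)" for z and \<alpha> :: "'n \<Rightarrow> nat"
  define d where "d \<alpha> = cmod (c \<alpha>) * \<delta> ^ (\<Sum>i\<in>UNIV. \<alpha> i)" for \<alpha> :: "'n \<Rightarrow> nat"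
  \<comment> \<open>At this corner every monomial is \<open>\<delta>\<close> to its total
    degree.\<close>
  have "((\<lambda>\<alpha>. c \<alpha> * (\<Prod>i\<in>UNIV. ((\<chi> i. a $ i + of_real \<delta>) $ i - a $ i) ^ \<alpha> i)) has_sum F (\<chi> i. a $ i + of_real \<delta>)) UNIV"
    by (rule ps) (use \<delta> in auto)
  then have "(\<lambda>\<alpha>. c \<alpha> * of_real \<delta> ^ (\<Sum>i\<in>UNIV. \<alpha> i)) summable_on UNIV"
    by (auto simp: power_sum summable_on_def)
  then have "(\<lambda>\<alpha>. norm (c \<alpha> * of_real \<delta> ^ (\<Sum>i\<in>UNIV. \<alpha> i))) summable_on UNIV"
    by (simp only: summable_on_iff_abs_summable_on_complex)
  then have dsum: "d summable_on UNIV"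
    using \<delta> unfolding d_def by (simp add: norm_mult norm_power)
  define K where "K = infsum d UNIV"
  have K0: "0 \<le> K" unfolding K_def by (intro infsum_nonneg) (use \<delta> in \<open>simp add: d_def\<close>)
  have Fa: "F a = c (\<lambda>_. 0)"
  proof -
    have "((\<lambda>\<alpha>. c \<alpha> * p a \<alpha>) has_sum F a) UNIV"
      unfolding p_def by (rule ps) (use \<epsilon> in auto)
    moreover have "((\<lambda>\<alpha>. c \<alpha> * p a \<alpha>) has_sum c (\<lambda>_. 0)) UNIV"
    proof (rule has_sum_finite_neutralI[where B = "{\<lambda>_. 0}"])
      fix \<alpha> :: "'n \<Rightarrow> nat" assume "\<alpha> \<in> UNIV - {\<lambda>_. 0}"
      then obtain i where "\<alpha> i \<noteq> 0" by (auto simp: fun_eq_iff)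
      then have "(a $ i - a $ i) ^ \<alpha> i = 0" by simp
      then have "p a \<alpha> = 0" unfolding p_def by (intro prod_zero) auto
      then show "c \<alpha> * p a \<alpha> = 0" by simp
    qed (auto simp: p_def)
    ultimately show ?thesis by (rule has_sum_unique)
  qed
  have est: "cmod (F z - F a) \<le> q * K" if q: "0 \<le> q" "q \<le> 1" and z: "\<And>i. cmod (z $ i - a $ i) \<le> q * \<delta>" for z q
  proof -
    have "q * \<delta> \<le> 1 * \<delta>" using q \<delta> by (intro mult_right_mono) auto
    then have "cmod (z $ i - a $ i) < \<epsilon>" for i using z[of i] \<delta> by linarith
    then have sz: "((\<lambda>\<alpha>. c \<alpha> * p z \<alpha>) has_sum F z) UNIV" unfolding p_def by (intro ps) auto
    \<comment> \<open>Cancelling the constant term leaves a series for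
      \<open>F z - F a\<close>.\<close>
    have "((\<lambda>\<alpha>. if \<alpha> = (\<lambda>_. 0) then - c \<alpha> else 0) has_sum - F a) UNIV"
      by (rule has_sum_finite_neutralI[where B = "{\<lambda>_. 0}"]) (auto simp: Fa)
    from has_sum_add[OF sz this]
    have diff: "((\<lambda>\<alpha>. c \<alpha> * p z \<alpha> + (if \<alpha> = (\<lambda>_. 0) then - c \<alpha> else 0)) has_sum (F z - F a)) UNIV"
      by simp
    have dq: "((\<lambda>\<alpha>. q * d \<alpha>) has_sum (q * K)) UNIV"
      unfolding K_def by (intro has_sum_cmult_right has_sum_infsum dsum)
    show ?thesis
    proof (rule norm_infsum_le[OF diff dq])
      fix \<alpha> :: "'n \<Rightarrow> nat"
      show "norm (c \<alpha> * p z \<alpha> + (if \<alpha> = (\<lambda>_. 0) then - c \<alpha> else 0)) \<le> q * d \<alpha>"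
      proof (cases "\<alpha> = (\<lambda>_. 0)")
        case True
        then show ?thesis using q \<delta> by (simp add: p_def d_def)
      next
        case False
        then obtain i where i: "\<alpha> i \<noteq> 0" by (auto simp: fun_eq_iff)
        have "\<alpha> i \<le> (\<Sum>i\<in>UNIV. \<alpha> i)" by (intro member_le_sum) auto
        then have s: "1 \<le> (\<Sum>i\<in>UNIV. \<alpha> i)" using i by linarith
        have "cmod (p z \<alpha>) \<le> (\<Prod>i\<in>UNIV. (q * \<delta>) ^ \<alpha> i)"
          unfolding p_def prod_norm[symmetric] norm_power
          by (intro prod_mono conjI power_mono z) auto
        also have "\<dots> = q ^ (\<Sum>i\<in>UNIV. \<alpha> i) * \<delta> ^ (\<Sum>i\<in>UNIV. \<alpha> i)"
          by (simp add: power_sum prod.distrib power_mult_distrib)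
        also have "\<dots> \<le> q * \<delta> ^ (\<Sum>i\<in>UNIV. \<alpha> i)"
          using power_decreasing[OF s q] \<delta> by (intro mult_right_mono) auto
        finally have "cmod (c \<alpha>) * cmod (p z \<alpha>) \<le> cmod (c \<alpha>) * (q * \<delta> ^ (\<Sum>i\<in>UNIV. \<alpha> i))"
          by (intro mult_left_mono) auto
        then show ?thesis using False by (simp add: norm_mult d_def mult_ac)
      qed
    qed
  qed
  show ?thesis
    unfolding isCont_def
  proof (rule Lim_null[THEN iffD2], rule tendsto_norm_zero_cancel, rule Lim_null_comparison)
    show "\<forall>\<^sub>F z in at a. norm (norm (F z - F a)) \<le> norm (z - a) / \<delta> * K"
    proof -
      have "\<forall>\<^sub>F z in at a. dist z a < \<delta>" using \<delta> by (auto simp: eventually_at)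
      then show ?thesis
      proof eventually_elim
        case (elim z)
        \<comment> \<open>Taken with \<open>q = norm (z - a) / \<delta>\<close>, since the Euclidean
          norm dominates each coordinate.\<close>
        have "cmod (F z - F a) \<le> norm (z - a) / \<delta> * K"
          by (rule est) (use elim \<delta> Finite_Cartesian_Product.norm_nth_le[of "z - a"] in \<open>auto simp: dist_norm\<close>)
        then show ?case by simp
      qed
    qed
    show "((\<lambda>z. norm (z - a) / \<delta> * K) \<longlongrightarrow> 0) (at a)"
      using \<delta> by (auto intro!: tendsto_eq_intros)
  qed
qed


section \<open>The error on a hyperrectangle\<close>

text \<open>Expanding the product of the one-dimensional Lagrange sums over multi-indices of degrees
  and exchanging the sums over degrees and nodes gives the tensor formula.\<close>

lemma cheb_interp_unit_eq_lagrange: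
  "cheb_interp_unit N f x = (\<Sum>k\<in>Pi\<^sub>E UNIV (\<lambda>i. {..N i}).
     (\<Prod>i\<in>UNIV. cheb_lagrange (N i) (k i) (x $ i)) * f (\<chi> i. cheb_node (N i) (k i)))"
proof -
  define P where "P = Pi\<^sub>E UNIV (\<lambda>i. {..N i})"
  define A where "A i j = (if 0 < j \<and> j < N i then 2 else 1) / real (N i)" for i j
  define W where "W i k = endpoint_weight (N i) k" for i k
  define C where "C i j k = cos (real j * pi * (real k / real (N i)))" for i j k
  define T where "T i j = poly (chebyshev_T j) (x $ i)" for i j
  have set: "{k. \<forall>i. k i \<le> N i} = P" by (auto simp: P_def PiE_def)
  have L: "(\<Prod>i\<in>UNIV. cheb_lagrange (N i) (k i) (x $ i)) =
      (\<Sum>j\<in>P. \<Prod>i\<in>UNIV. A i (j i) * W i (k i) * C i (j i) (k i) * T i (j i))" for k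
    unfolding cheb_lagrange_def P_def A_def W_def C_def T_def by (rule prod_sum_PiE) auto
  have "cheb_interp_unit N f x = (\<Sum>j\<in>P. (\<Prod>i\<in>UNIV. A i (j i)) *
      (\<Sum>k\<in>P. (\<Prod>i\<in>UNIV. W i (k i)) * f (\<chi> i. cheb_node (N i) (k i)) * (\<Prod>i\<in>UNIV. C i (j i) (k i))) *
      (\<Prod>i\<in>UNIV. T i (j i)))"
    unfolding cheb_interp_unit_def cheb_coeff_def set A_def W_def C_def T_def ..
  also have "\<dots> = (\<Sum>j\<in>P. \<Sum>k\<in>P. (\<Prod>i\<in>UNIV. A i (j i) * W i (k i) * C i (j i) (k i) * T i (j i)) *
      f (\<chi> i. cheb_node (N i) (k i)))"
    unfolding sum_distrib_left sum_distrib_right prod.distrib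
    by (intro sum.cong refl) (simp only: mult_ac)
  also have "\<dots> = (\<Sum>k\<in>P. (\<Prod>i\<in>UNIV. cheb_lagrange (N i) (k i) (x $ i)) * f (\<chi> i. cheb_node (N i) (k i)))"
    unfolding L by (subst sum.swap) (simp only: sum_distrib_right)
  finally show ?thesis unfolding P_def .
qed

text \<open>Here \<open>z\<close> is arbitrary because, with \<open>S = UNIV\<close>, every
  coordinate is replaced by a node.\<close>

lemma of_real_cheb_interp_unit:
  assumes "\<And>y. (\<And>i. y $ i \<in> {-1..1}) \<Longrightarrow> G (\<lambda>i. complex_of_real (y $ i)) = of_real (f y)"
  shows "of_real (cheb_interp_unit N f x) = partial_interp N (\<lambda>i k. of_real (cheb_lagrange (N i) k (x $ i)))
    (\<lambda>i k. of_real (cheb_node (N i) k)) UNIV G z"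
proof -
  have "G (\<lambda>i. of_real (cheb_node (N i) (k i))) = of_real (f (\<chi> i. cheb_node (N i) (k i)))" for k
    using assms[of "\<chi> i. cheb_node (N i) (k i)"] by (simp add: cheb_node_def)
  then show ?thesis
    unfolding cheb_interp_unit_eq_lagrange partial_interp_def by simp
qed

section \<open>Transport between the cube and the hyperrectangle\<close>

text \<open>On the segment between the foci the two distances add up to 2, and
  \<open>r + 1 / r - 2 = (r - 1)\<^sup>2 / r\<close> is positive.\<close>

lemma of_real_in_bernstein:
  assumes "1 < r" "x \<in> {-1..1}"
  shows "complex_of_real x \<in> bernstein r"
proof -
  have "0 < (r - 1)\<^sup>2 / r" using assms by simp
  then have "2 < r + 1 / r" using assms by (simp add: field_simps power2_eq_square)
  moreover have "dist (complex_of_real x) 1 = 1 - x" "dist (complex_of_real x) (-1) = x + 1"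
  proof -
    have "complex_of_real x - 1 = of_real (x - 1)" "complex_of_real x - (-1) = of_real (x + 1)" by simp_all
    then show "dist (complex_of_real x) 1 = 1 - x" "dist (complex_of_real x) (-1) = x + 1"
      using assms unfolding dist_norm by (simp_all only: norm_of_real) auto
  qed
  ultimately show ?thesis by (simp add: bernstein_def)
qed

lemma tau_of_real: "tau l u (complex_of_real x) = of_real (tau l u x)"
  by (simp add: tau_def)

lemma tau_vec_nth: "tau_vec l u x $ i = u $ i + (l $ i - u $ i) / 2 * (1 - x $ i)"
  by (simp add: tau_vec_def tau_def)

lemma inj_tau_vec:
  assumes "\<And>i. l $ i < u $ i"
  shows "inj (tau_vec l u)"
proof (rule injI)
  fix x y assume "tau_vec l u x = tau_vec l u y"
  then have "(l $ i - u $ i) / 2 * (1 - x $ i) = (l $ i - u $ i) / 2 * (1 - y $ i)" for i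
    by (metis tau_vec_nth add_left_cancel)
  moreover have "l $ i - u $ i \<noteq> 0" for i using assms[of i] by simp
  ultimately show "x = y" by (simp add: vec_eq_iff)
qed

lemma tau_vec_image:
  assumes lu: "\<And>i. l $ i < u $ i"
  shows "tau_vec l u ` {y. \<forall>i. y $ i \<in> {-1..1}} = cbox l u"
proof (rule set_eqI, rule iffI)
  fix x assume "x \<in> tau_vec l u ` {y. \<forall>i. y $ i \<in> {-1..1}}"
  then obtain y where y: "\<And>i. y $ i \<in> {-1..1}" and x: "x = tau_vec l u y" by blast
  have "l $ i \<le> x $ i \<and> x $ i \<le> u $ i" for i
  proof -
    have e: "x $ i = u $ i - (u $ i - l $ i) * ((1 - y $ i) / 2)"
      by (simp add: x tau_vec_nth field_simps)
    have "(u $ i - l $ i) * ((1 - y $ i) / 2) \<le> (u $ i - l $ i) * 1"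
      "0 \<le> (u $ i - l $ i) * ((1 - y $ i) / 2)"
      using lu[of i] y[of i] by (intro mult_left_mono mult_nonneg_nonneg; simp)+
    then show ?thesis unfolding e by simp
  qed
  then show "x \<in> cbox l u" by (simp add: mem_box_cart)
next
  fix x assume x: "x \<in> cbox l u"
  define y where "y = (\<chi> i. 1 - 2 * (u $ i - x $ i) / (u $ i - l $ i))"
  have d: "u $ i - l $ i > 0" for i using lu[of i] by simp
  have "tau_vec l u y $ i = x $ i" for i
  proof -
    have "(l $ i - u $ i) / 2 * (1 - y $ i) = - (u $ i - x $ i)"
      using d[of i] by (simp add: y_def divide_simps) (simp add: algebra_simps)
    then show ?thesis unfolding tau_vec_nth by linarith
  qed
  then have "x = tau_vec l u y" by (simp add: vec_eq_iff)
  moreover have "y $ i \<in> {-1..1}" for i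
    using x d[of i] by (auto simp: y_def mem_box_cart field_simps)
  ultimately show "x \<in> tau_vec l u ` {y. \<forall>i. y $ i \<in> {-1..1}}" by blast
qed

lemma cheb_interp_tau_vec:
  assumes "\<And>i. l $ i < u $ i"
  shows "cheb_interp l u N f (tau_vec l u y) = cheb_interp_unit N (f \<circ> tau_vec l u) y"
  by (simp add: cheb_interp_def inv_f_f[OF inj_tau_vec[OF assms]])

lemma continuous_on_cheb_interp_unit: "continuous_on S (cheb_interp_unit N f)"
  unfolding cheb_interp_unit_def by (intro continuous_intros)

text \<open>Differentiability is local: near each point the function is a slice of \<open>F\<close>
  through the image point \<open>a\<close>, composed with the affine map of coordinate
  \<open>i\<close>.\<close>

lemma separately_holomorphic_on_transport:
  assumes F: "mv_analytic_on F (gen_bernstein l u \<rho>)"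
  shows "(\<lambda>z. F (\<chi> i. tau (l $ i) (u $ i) (z i))) separately_holomorphic_on (\<lambda>i. bernstein (\<rho> $ i))"
  unfolding separately_holomorphic_on_def
proof (intro ballI allI)
  fix z i assume z: "z \<in> Pi UNIV (\<lambda>i. bernstein (\<rho> $ i))"
  define H where "H = (\<lambda>t. F (\<chi> j. tau (l $ j) (u $ j) ((z(i := t)) j)))"
  have "H field_differentiable at t" if t: "t \<in> bernstein (\<rho> $ i)" for t
  proof -
    define a where "a = (\<chi> j. tau (l $ j) (u $ j) ((z(i := t)) j))"
    have "a \<in> gen_bernstein l u \<rho>"
      using z t by (auto simp: a_def gen_bernstein_def bernstein_interval_def Pi_iff)
    then obtain \<epsilon> where "\<epsilon> > 0" and
      hol: "(\<lambda>v. F (\<chi> j. if j = i then v else a $ j)) holomorphic_on ball (a $ i) \<epsilon>"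
      using exists_ball_slice_holomorphic[OF F] by blast
    then have "(\<lambda>v. F (\<chi> j. if j = i then v else a $ j)) field_differentiable at (tau (l $ i) (u $ i) t)"
      by (intro holomorphic_on_imp_differentiable_at[OF hol]) (auto simp: a_def)
    moreover have "(\<lambda>t. tau (l $ i) (u $ i) t) field_differentiable at t"
      unfolding tau_def by (intro derivative_intros)
    ultimately have "((\<lambda>v. F (\<chi> j. if j = i then v else a $ j)) \<circ> (\<lambda>t. tau (l $ i) (u $ i) t)) field_differentiable at t"
      by (intro field_differentiable_compose)
    moreover have "(\<lambda>v. F (\<chi> j. if j = i then v else a $ j)) \<circ> (\<lambda>t. tau (l $ i) (u $ i) t) = H"
    proof
      fix s
      have "(\<chi> j. if j = i then tau (l $ i) (u $ i) s else a $ j) = (\<chi> j. tau (l $ j) (u $ j) ((z(i := s)) j))"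
        by (simp add: vec_eq_iff a_def)
      then show "((\<lambda>v. F (\<chi> j. if j = i then v else a $ j)) \<circ> (\<lambda>t. tau (l $ i) (u $ i) t)) s = H s"
        by (simp add: H_def)
    qed
    ultimately show ?thesis by (simp only:)
  qed
  then show "(\<lambda>t. F (\<chi> j. tau (l $ j) (u $ j) ((z(i := t)) j))) holomorphic_on bernstein (\<rho> $ i)"
    unfolding H_def[symmetric] holomorphic_on_def by (blast intro: field_differentiable_at_within)
qed

section \<open>The claimed bound and the maximum\<close>

text \<open>For \<open>k = 1\<close> the product is empty and the first summand suffices; for
  \<open>k \<ge> 2\<close> the second summand alone dominates.\<close>

lemma interp_error_term_le:
  fixes m :: real and p :: "nat \<Rightarrow> real"
  assumes m: "0 \<le> m" and k: "1 \<le> k" and p: "\<And>j. 0 < p j"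
  shows "(\<Prod>j=1..k - 1. 2 / p j) * m \<le>
    m + m * (2 ^ (k - 1) * ((real (k - 1) + 2 ^ (k - 1) - 1) / (\<Prod>j=1..k - 1. p j)))"
proof (cases "k = 1")
  case False
  define Q where "Q = (\<Prod>j=1..k - 1. p j)"
  have Q: "0 < Q" unfolding Q_def by (intro prod_pos p ballI)
  have "1 \<le> real (k - 1)" using k False by simp
  moreover have "(1::real) \<le> 2 ^ (k - 1)" by simp
  ultimately have "1 \<le> real (k - 1) + 2 ^ (k - 1) - 1" by linarith
  then have "2 ^ (k - 1) / Q * m * 1 \<le> 2 ^ (k - 1) / Q * m * (real (k - 1) + 2 ^ (k - 1) - 1)"
    using m Q by (intro mult_left_mono) auto
  then have "2 ^ (k - 1) / Q * m \<le> m * (2 ^ (k - 1) * ((real (k - 1) + 2 ^ (k - 1) - 1) / Q))"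
    by (simp add: mult_ac)
  then show ?thesis
    using m by (simp add: prod_dividef Q_def)
qed (use m in simp)

text \<open>The telescoping estimate applied to the pull-back \<open>G\<close> of \<open>F\<close>
  to the standard ellipses, with the one-dimensional stability and error constants for
  \<open>C\<close> and \<open>c\<close>. The enumeration \<open>b\<close> fixes the order in which
  the coordinates are interpolated.\<close>

lemma cheb_interp_telescoped_error_le:
  fixes l u \<rho> :: "real ^ 'n::finite" and b :: "nat \<Rightarrow> 'n"
  assumes lu: "\<And>i. l $ i < u $ i" and N: "\<And>i. N i \<ge> 1" and \<rho>: "\<And>i. \<rho> $ i > 1"
    and analytic: "mv_analytic_on F (gen_bernstein l u \<rho>)"
    and ext: "\<And>x. x \<in> cbox l u \<Longrightarrow> F (complex_vec x) = of_real (f x)"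
    and bound: "\<And>z. z \<in> gen_bernstein l u \<rho> \<Longrightarrow> cmod (F z) \<le> V"
    and b: "bij_betw b {1..n} UNIV" and x: "x \<in> cbox l u"
  shows "\<bar>f x - cheb_interp l u N f x\<bar> \<le>
     (\<Sum>k = 1..n. (\<Prod>j = 1..k - 1. 2 / (1 - 1 / \<rho> $ b j)) *
        (4 * V * ((1 / \<rho> $ b k) ^ N (b k) / (\<rho> $ b k - 1))))"
proof -
  obtain y where y: "\<And>i. y $ i \<in> {-1..1}" and xy: "x = tau_vec l u y"
    using x unfolding tau_vec_image[OF lu, symmetric] by blast
  define E where "E = (\<lambda>i. bernstein (\<rho> $ i))"
  define G where "G = (\<lambda>z. F (\<chi> i. tau (l $ i) (u $ i) (z i)))"
  have G: "G separately_holomorphic_on E"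
    unfolding G_def E_def by (rule separately_holomorphic_on_transport[OF analytic])
  have real: "G (\<lambda>i. of_real (y $ i)) = of_real ((f \<circ> tau_vec l u) y)"
    if "\<And>i. y $ i \<in> {-1..1}" for y
  proof -
    have "tau_vec l u y \<in> cbox l u" using that tau_vec_image[OF lu] by blast
    moreover have "(\<chi> i. tau (l $ i) (u $ i) (complex_of_real (y $ i))) = complex_vec (tau_vec l u y)"
      by (simp add: complex_vec_def tau_vec_def tau_of_real)
    ultimately show ?thesis using ext by (simp add: G_def)
  qed
  define w where "w = (\<lambda>i k. complex_of_real (cheb_lagrange (N i) k (y $ i)))"
  define \<nu> where "\<nu> = (\<lambda>i k. complex_of_real (cheb_node (N i) k))"
  have "cmod (G (\<lambda>i. of_real (y $ i)) - partial_interp N w \<nu> (b ` {1..n}) G (\<lambda>i. of_real (y $ i))) \<le>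
     (\<Sum>k=1..n. (\<Prod>j=1..k - 1. 2 / (1 - 1 / \<rho> $ b j)) *
       (4 * ((1 / \<rho> $ b k) ^ N (b k) / (\<rho> $ b k - 1)) * V))"
  proof (rule norm_partial_interp_error_le[where E = E and G = G and x = "\<lambda>i. of_real (y $ i)"
        and w = w and \<nu> = \<nu> and N = N and C = "\<lambda>i. 2 / (1 - 1 / \<rho> $ i)"
        and c = "\<lambda>i. 4 * ((1 / \<rho> $ i) ^ N i / (\<rho> $ i - 1))"])
    show "inj_on b {1..n}" using b by (simp add: bij_betw_def)
    show "\<nu> i k \<in> E i" for i k
      unfolding \<nu>_def E_def by (rule of_real_in_bernstein[OF \<rho>]) (simp add: cheb_node_def)
    show "of_real (y $ i) \<in> E i" for i
      unfolding E_def by (rule of_real_in_bernstein[OF \<rho> y])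
    show "cmod (G z) \<le> V" if "\<And>i. z i \<in> E i" for z
      unfolding G_def by (rule bound) (use that in \<open>auto simp: gen_bernstein_def bernstein_interval_def E_def\<close>)
    fix i h M assume h: "h holomorphic_on E i" "\<And>t. t \<in> E i \<Longrightarrow> cmod (h t) \<le> M"
    show "cmod (\<Sum>k\<le>N i. w i k * h (\<nu> i k)) \<le> 2 / (1 - 1 / \<rho> $ i) * M"
      using Chebyshev_interp_bound[OF h[unfolded E_def] \<rho> N y[of i]]
      unfolding w_def \<nu>_def by simp
    show "cmod (h (of_real (y $ i)) - (\<Sum>k\<le>N i. w i k * h (\<nu> i k))) \<le>
        4 * ((1 / \<rho> $ i) ^ N i / (\<rho> $ i - 1)) * M"
      using Chebyshev_interp_error[OF h[unfolded E_def] \<rho> N y[of i]]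
      unfolding w_def \<nu>_def by (simp add: mult_ac)
  qed (rule G)
  moreover have "b ` {1..n} = UNIV" using b by (simp add: bij_betw_def)
  moreover have "partial_interp N w \<nu> UNIV G (\<lambda>i. of_real (y $ i)) = of_real (cheb_interp l u N f x)"
    unfolding xy cheb_interp_tau_vec[OF lu] w_def \<nu>_def
    by (rule of_real_cheb_interp_unit[where G = G, symmetric]) (rule real)
  moreover have "G (\<lambda>i. of_real (y $ i)) = of_real (f x)"
    using real[OF y] by (simp add: xy)
  moreover have "cmod (of_real (f x) - of_real (cheb_interp l u N f x)) = \<bar>f x - cheb_interp l u N f x\<bar>"
    by (metis norm_of_real of_real_diff)
  ultimately show ?thesis by (simp add: mult_ac)
qed

lemma cheb_interp_error_le:
  fixes l u \<rho> :: "real ^ 'n::finite" and b :: "nat \<Rightarrow> 'n"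
  assumes lu: "\<And>i. l $ i < u $ i" and N: "\<And>i. N i \<ge> 1" and \<rho>: "\<And>i. \<rho> $ i > 1"
    and analytic: "mv_analytic_on F (gen_bernstein l u \<rho>)"
    and ext: "\<And>x. x \<in> cbox l u \<Longrightarrow> F (complex_vec x) = of_real (f x)"
    and bound: "\<And>z. z \<in> gen_bernstein l u \<rho> \<Longrightarrow> cmod (F z) \<le> V" and V: "0 \<le> V"
    and b: "bij_betw b {1..n} UNIV" and x: "x \<in> cbox l u"
  shows "\<bar>f x - cheb_interp l u N f x\<bar> \<le>
        (\<Sum>i = 1..n. 4 * V * (\<rho> $ b i powi (- int (N (b i))) / (\<rho> $ b i - 1))) +
        (\<Sum>k = 2..n. 4 * V * (\<rho> $ b k powi (- int (N (b k))) / (\<rho> $ b k - 1)) *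
           (2 ^ (k - 1) * ((real (k - 1) + 2 ^ (k - 1) - 1) / (\<Prod>j = 1..k - 1. 1 - 1 / \<rho> $ b j))))"
proof -
  define m where "m k = 4 * V * ((1 / \<rho> $ b k) ^ N (b k) / (\<rho> $ b k - 1))" for k
  define p where "p j = 1 - 1 / \<rho> $ b j" for j
  define T where "T k = m k * (2 ^ (k - 1) * ((real (k - 1) + 2 ^ (k - 1) - 1) / (\<Prod>j = 1..k - 1. p j)))" for k
  have m0: "0 \<le> m k" for k
  proof -
    have "1 < \<rho> $ b k" by (rule \<rho>)
    then show ?thesis unfolding m_def using V by simp
  qed
  have p0: "0 < p j" for j using \<rho>[of "b j"] by (simp add: p_def)
  have powi: "v powi (- int n) = (1 / v) ^ n" for v :: real and n
    by (simp add: power_int_minus power_one_over inverse_eq_divide)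
  have "\<bar>f x - cheb_interp l u N f x\<bar> \<le> (\<Sum>k = 1..n. (\<Prod>j = 1..k - 1. 2 / p j) * m k)"
    unfolding m_def p_def by (rule cheb_interp_telescoped_error_le[OF lu N \<rho> analytic ext bound b x])
  also have "\<dots> \<le> (\<Sum>k = 1..n. m k + T k)"
    unfolding T_def by (intro sum_mono interp_error_term_le m0 p0) auto
  also have "\<dots> = (\<Sum>k = 1..n. m k) + (\<Sum>k = 1..n. T k)"
    by (rule sum.distrib)
  \<comment> \<open>\<open>T 1\<close> vanishes because its factor is
    \<open>0 + 2 ^ 0 - 1\<close>.\<close>
  also have "(\<Sum>k = 1..n. T k) = (\<Sum>k = 2..n. T k)"
    by (rule sum.mono_neutral_right) (auto simp: T_def not_le less_Suc_eq numeral_2_eq_2)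
  finally show ?thesis
    unfolding powi T_def m_def p_def .
qed

lemma le_MIN_I:
  fixes c :: "'a::linorder"
  assumes "finite S" "S \<noteq> {}" "\<And>s. s \<in> S \<Longrightarrow> c \<le> g s"
  shows "c \<le> (MIN s\<in>S. g s)"
  using assms by (intro Min.boundedI) auto


text \<open>The maximum is expressed by a point \<open>x\<^sub>0\<close> where it is attained, and
  \<open>e\<close> numbers the coordinates so that permutations of \<open>{1..CARD('n)}\<close> can
  act on them.\<close>

theorem proposition3p1:
  fixes l u \<rho> :: "real ^ 'n::finite"
    and N :: "'n \<Rightarrow> nat"
    and f :: "real ^ 'n \<Rightarrow> real"
    and F :: "complex ^ 'n \<Rightarrow> complex"
    and V :: real
    and e :: "nat \<Rightarrow> 'n"
  assumes numbering: "bij_betw e {1..CARD('n)} UNIV"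
    and hyperrectangle: "\<And>i. l $ i < u $ i"
    and N: "\<And>i. N i \<ge> 1"
    and \<rho>: "\<And>i. \<rho> $ i > 1"
    and analytic: "mv_analytic_on F (gen_bernstein l u \<rho>)"
    and extension: "\<And>x. x \<in> cbox l u \<Longrightarrow> F (complex_vec x) = complex_of_real (f x)"
    and bound: "\<And>z. z \<in> gen_bernstein l u \<rho> \<Longrightarrow> cmod (F z) \<le> V"
  shows "\<exists>x\<^sub>0 \<in> cbox l u.
    (\<forall>x \<in> cbox l u. \<bar>f x - cheb_interp l u N f x\<bar> \<le> \<bar>f x\<^sub>0 - cheb_interp l u N f x\<^sub>0\<bar>) \<and>
    \<bar>f x\<^sub>0 - cheb_interp l u N f x\<^sub>0\<bar> \<le>
      (MIN \<sigma> \<in> {\<sigma>. \<sigma> permutes {1..CARD('n)}}.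
        (\<Sum>i = 1..CARD('n).
           4 * V * ((\<rho> $ e (\<sigma> i)) powi (- int (N (e (\<sigma> i)))) / (\<rho> $ e (\<sigma> i) - 1))) +
        (\<Sum>k = 2..CARD('n).
           4 * V * ((\<rho> $ e (\<sigma> k)) powi (- int (N (e (\<sigma> k)))) / (\<rho> $ e (\<sigma> k) - 1)) *
           (2 ^ (k - 1) * ((real (k - 1) + 2 ^ (k - 1) - 1) /
              (\<Prod>j = 1..k - 1. 1 - 1 / \<rho> $ e (\<sigma> j))))))"
proof -
  define Y where "Y = {y :: real ^ 'n. \<forall>i. y $ i \<in> {-1..1}}"
  have Y: "tau_vec l u ` Y = cbox l u" unfolding Y_def by (rule tau_vec_image[OF hyperrectangle])
  have Ybox: "Y = cbox (\<chi> i. - 1) (\<chi> i. 1)" by (auto simp: Y_def mem_box_cart)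
  have "0 \<in> Y" by (simp add: Y_def)
  have in_gen: "complex_vec (tau_vec l u y) \<in> gen_bernstein l u \<rho>" if "y \<in> Y" for y
    using that of_real_in_bernstein[OF \<rho>]
    by (auto simp: Y_def complex_vec_def tau_vec_def gen_bernstein_def bernstein_interval_def
        tau_of_real[symmetric])
  \<comment> \<open>The ellipse product contains the centre of the hyperrectangle, the image of 0,
    and there \<open>V\<close> bounds a modulus.\<close>
  have V: "0 \<le> V" using bound[OF in_gen[OF \<open>0 \<in> Y\<close>]] norm_ge_zero order_trans by blast
  have cont_vec: "continuous_on Y (\<lambda>y. complex_vec (tau_vec l u y))"
    unfolding complex_vec_def tau_vec_nth by (intro continuous_intros)
  have cont_F: "continuous_on (gen_bernstein l u \<rho>) F"
    by (intro continuous_at_imp_continuous_on ballI isCont_mv_analytic[OF analytic])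
  have "continuous_on Y (\<lambda>y. F (complex_vec (tau_vec l u y)))"
    by (rule continuous_on_compose2[OF cont_F cont_vec]) (use in_gen in auto)
  then have "continuous_on Y (\<lambda>y. Re (F (complex_vec (tau_vec l u y))))"
    by (rule continuous_on_Re)
  \<comment> \<open>Continuity of \<open>f\<close> on the hyperrectangle is inherited from its
    analytic extension.\<close>
  moreover have "Re (F (complex_vec (tau_vec l u y))) = f (tau_vec l u y)" if "y \<in> Y" for y
    using extension Y that by (metis Re_complex_of_real imageI)
  ultimately have "continuous_on Y (\<lambda>y. f (tau_vec l u y))"
    by (rule continuous_on_eq)
  then have "continuous_on Y (\<lambda>y. \<bar>f (tau_vec l u y) - cheb_interp l u N f (tau_vec l u y)\<bar>)"
    unfolding cheb_interp_tau_vec[OF hyperrectangle]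
    by (intro continuous_intros continuous_on_cheb_interp_unit)
  moreover have "compact Y" unfolding Ybox by (rule compact_cbox)
  ultimately obtain y where y: "y \<in> Y" and max: "\<forall>x\<in>cbox l u.
      \<bar>f x - cheb_interp l u N f x\<bar> \<le> \<bar>f (tau_vec l u y) - cheb_interp l u N f (tau_vec l u y)\<bar>"
    using continuous_attains_sup[of Y] \<open>0 \<in> Y\<close> unfolding Y[symmetric] by blast
  have x0: "tau_vec l u y \<in> cbox l u" using y Y by blast
  show ?thesis
  proof (intro bexI[OF _ x0] conjI max le_MIN_I)
    show "finite {\<sigma>. \<sigma> permutes {1..CARD('n)}}" by (intro finite_permutations) simp
    show "{\<sigma>. \<sigma> permutes {1..CARD('n)}} \<noteq> {}" using permutes_id by blast
    fix \<sigma> assume "\<sigma> \<in> {\<sigma>. \<sigma> permutes {1..CARD('n)}}"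
    \<comment> \<open>Each permutation yields an enumeration of the coordinates, hence its own
      bound; their minimum is then also a bound.\<close>
    then have "bij_betw (\<lambda>k. e (\<sigma> k)) {1..CARD('n)} UNIV"
      using bij_betw_trans[OF permutes_imp_bij numbering] by (simp add: o_def)
    from cheb_interp_error_le[OF hyperrectangle N \<rho> analytic extension bound V this x0]
    show "\<bar>f (tau_vec l u y) - cheb_interp l u N f (tau_vec l u y)\<bar> \<le>
        (\<Sum>i = 1..CARD('n).
           4 * V * ((\<rho> $ e (\<sigma> i)) powi (- int (N (e (\<sigma> i)))) / (\<rho> $ e (\<sigma> i) - 1))) +
        (\<Sum>k = 2..CARD('n).
           4 * V * ((\<rho> $ e (\<sigma> k)) powi (- int (N (e (\<sigma> k)))) / (\<rho> $ e (\<sigma> k) - 1)) *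
           (2 ^ (k - 1) * ((real (k - 1) + 2 ^ (k - 1) - 1) /
              (\<Prod>j = 1..k - 1. 1 - 1 / \<rho> $ e (\<sigma> j)))))"
      .
  qed
qed

end
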